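(* Suppose Assumptions A, B and C (stated in the context) hold. Let $\alpha_k>0$ be primal stepsizes and $\lambda_k>0$ dual weights satisfying $\alpha_k=\lambda_k/(\mu\sum_{i=0}^k\lambda_i)$ for all $k\ge 0$. Let $T\ge 1$ be such that at least one feasible iterate has occurred, i.e. $\sum_{k<T:\,s(x_k)=0}\lambda_k>0$. Then the stochastic switching proximal subgradient method satisfies $$\mathbb{E}_\xi\left[\left(\frac{\sum_{k<T:\,s(x_k)=0}\lambda_k}{\sum_{k=0}^{T-1}\lambda_k}\right)\big(\mathtt{primal\text{-}gap}_T+\mathtt{dual\text{-}gap}_T\big)+\frac{\mu}{2}\|x_T-x_{\mathtt{OPT}}\|_2^2\right]\le\frac{L_0^2\sum_{k=0}^{T-1}\lambda_k\alpha_k+C_0}{\sum_{k=0}^{T-1}\lambda_k}.$$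
   Context: **Problem.** Let $\mathcal{E}$ be a finite-dimensional Euclidean space, $m\ge 0$ an integer, $f_0,\dots,f_m\colon\mathcal{E}\to\mathbb{R}$, and $r\colon\mathcal{E}\to\mathbb{R}\cup\{\infty\}$ proper closed convex. Let $p_\star$ be the minimum of $f_0(x)+r(x)$ subject to $f_s(x)\le 0$, $s=1,\dots,m$. A point $x$ is called feasible if $f_s(x)\le 0$ for all $s=1,\dots,m$ (regardless of $r(x)$). The selection rule has $s(x)=0$ if $x$ is feasible, and otherwise $s(x)\in\{1,\dots,m\}$ is some choice of violated constraint, $f_{s(x)}(x)>0$. Stochastic oracles $g_s(x;\xi)$ satisfy $\mathbb{E}_\xi g_s(x;\xi)\in\partial f_s(x)$; $\xi_0,\xi_1,\dots$ are i.i.d.; $\mathbb{E}_\xi$ is expectation over all samples and $\mathbb{E}_{\xi_k}$ expectation over $\xi_k$ with $x_k$ fixed. $\mathrm{prox}_{\alpha,r}(z)=\operatorname{argmin}_x\{r(x)+\frac{1}{2\alpha}\|x-z\|_2^2\}$. **Method.** From a given $x_0\in\mathcal{E}$, $$x_{k+1}=\begin{cases}\mathrm{prox}_{\alpha_k,r}(x_k-\alpha_kg_0(x_k;\xi_k))&\text{if }x_k\text{ is feasible},\\ x_k-\alpha_kg_{s(x_k)}(x_k;\xi_k)&\text{otherwise.}\end{cases}$$ **Assumption A.** There is $\mu>0$ such that each $f_s$, $s=0,\dots,m$, is $\mu$-strongly convex (i.e. $f_s-\frac{\mu}{2}\|\cdot\|_2^2$ is convex). **Assumption B.** There is $x_{\mathtt{SL}}\in\mathrm{dom}\,\partial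 r$ with $f_s(x_{\mathtt{SL}})<0$ for all $s=1,\dots,m$. **Reference quantities.** $x_{\mathtt{OPT}}\in\mathrm{dom}\,\partial r$ is the unique minimizer of the problem. Fix $n_{x_{\mathtt{OPT}}}\in\partial r(x_{\mathtt{OPT}})$ such that $x\mapsto f_0(x)+r(x_{\mathtt{OPT}})+\langle n_{x_{\mathtt{OPT}}},x-x_{\mathtt{OPT}}\rangle$ is minimized over $\{x: f_s(x)\le 0,\ s=1,\dots,m\}$ at $x_{\mathtt{OPT}}$, and fix any $n_{x_{\mathtt{SL}}}\in\partial r(x_{\mathtt{SL}})$. For $y\in\{x_{\mathtt{OPT}},x_{\mathtt{SL}}\}$ let $h_y(x)=f_0(x)+r(y)+\langle n_y,x-y\rangle$ and $$\delta_k(y)=\begin{cases}h_y(x_k)-h_y(y)&\text{if }x_k\text{ is feasible},\\ f_{s(x_k)}(x_k)-f_{s(x_k)}(y)&\text{otherwise.}\end{cases}$$ **Assumption C.** There are constants $L_0,L_1\ge 0$ such that for both $y\in\{x_{\mathtt{OPT}},x_{\mathtt{SL}}\}$ every iterate $x_k$ satisfies: if $x_k$ is feasible, $\mathbb{E}_{\xi_k}\|g_0(x_k;\xi_k)+n_y\|_2^2\le L_0^2+L_1\delta_k(y)$; if $x_k$ is not feasible, $\mathbb{E}_{\xi_k}\|g_{s(x_k)}(x_k;\xi_k)\|_2^2\le L_0^2+L_1\delta_k(y)$. **Constants.** $T_0=\sup\{k\in\{0,1,2,\dots\}: L_1\alpha_k>1\}$ (equal to $-\infty$ if the set is empty) and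 $$C_0=\sum_{k=0}^{T_0}\lambda_k\max\{L_1\alpha_k-1,0\}\max\{\mathbb{E}_\xi\delta_k(x_{\mathtt{OPT}}),\mathbb{E}_\xi\delta_k(x_{\mathtt{SL}})\}$$ (equal to $0$ if $T_0=-\infty$). **Aggregate model.** For feasible $x_k$ let $n_{k+1}=\frac{1}{\alpha_k}(x_k-\alpha_kg_0(x_k;\xi_k)-x_{k+1})\in\partial r(x_{k+1})$, and $$M^{(T-1)}(x)=\sum_{k<T}\lambda_k\Big(f_{s(x_k)}(x_k)+\langle g_{s(x_k)}(x_k;\xi_k),x-x_k\rangle+\tfrac{\mu}{2}\|x-x_k\|_2^2\Big)+\sum_{k<T:\,s(x_k)=0}\lambda_k\big(r(x_{k+1})+\langle n_{k+1},x-x_{k+1}\rangle\big).$$ **Gaps** (defined once $\sum_{k<T:\,s(x_k)=0}\lambda_k>0$): $$\mathtt{primal\text{-}gap}_T=\frac{\sum_{k<T:\,s(x_k)=0}\lambda_kh_{x_{\mathtt{OPT}}}(x_k)}{\sum_{k<T:\,s(x_k)=0}\lambda_k}-p_\star,\qquad \mathtt{dual\text{-}gap}_T=p_\star-\inf_x\frac{M^{(T-1)}(x)}{\sum_{k<T:\,s(x_k)=0}\lambda_k}.$$ *)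

theory Defs
  imports "HOL-Probability.Probability"
begin

definition strongly_convex :: "real \<Rightarrow> ('a::euclidean_space \<Rightarrow> real) \<Rightarrow> bool" where
  "strongly_convex \<mu> f \<longleftrightarrow> convex_on UNIV (\<lambda>x. f x - \<mu> / 2 * (norm x)\<^sup>2)"

text \<open>The library's \<open>epigraph\<close> is restricted to real-valued functions.\<close>

definition ereal_epigraph :: "('a \<Rightarrow> ereal) \<Rightarrow> ('a \<times> real) set" where
  "ereal_epigraph r = {(x, t). r x \<le> ereal t}"

definition proper_closed_convex :: "('a::euclidean_space \<Rightarrow> ereal) \<Rightarrow> bool" where
  "proper_closed_convex r \<longleftrightarrow>
     (\<forall>x. r x \<noteq> -\<infinity>) \<and> (\<exists>x. r x \<noteq> \<infinity>) \<and>
     closed (ereal_epigraph r) \<and> convex (ereal_epigraph r)"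

text \<open>For proper \<open>r\<close> this is empty wherever \<open>r x = \<infinity>\<close>; hence \<open>n \<in> subdiff r x\<close>
  entails that \<open>x\<close> lies in the domain of the subdifferential.\<close>

definition subdiff :: "('a::euclidean_space \<Rightarrow> ereal) \<Rightarrow> 'a \<Rightarrow> 'a set" where
  "subdiff r x = {n. \<forall>y. r x + ereal (n \<bullet> (y - x)) \<le> r y}"

text \<open>For proper closed convex \<open>r\<close> and \<open>a > 0\<close> the minimizer exists and is unique.\<close>

definition prox :: "real \<Rightarrow> ('a::euclidean_space \<Rightarrow> ereal) \<Rightarrow> 'a \<Rightarrow> 'a" where
  "prox a r z = arg_min (\<lambda>x. r x + ereal (1 / (2 * a) * (norm (x - z))\<^sup>2)) (\<lambda>_. True)"

text \<open>Here \<open>f 0\<close> is the objective and \<open>f 1, \<dots>, f m\<close> are the constraints.\<close>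

definition feasible :: "(nat \<Rightarrow> 'a \<Rightarrow> real) \<Rightarrow> nat \<Rightarrow> 'a \<Rightarrow> bool" where
  "feasible f m x \<longleftrightarrow> (\<forall>i\<in>{1..m}. f i x \<le> 0)"

definition objective :: "(nat \<Rightarrow> 'a \<Rightarrow> real) \<Rightarrow> ('a \<Rightarrow> ereal) \<Rightarrow> 'a \<Rightarrow> ereal" where
  "objective f r x = ereal (f 0 x) + r x"

definition opt_value :: "(nat \<Rightarrow> 'a \<Rightarrow> real) \<Rightarrow> nat \<Rightarrow> ('a \<Rightarrow> ereal) \<Rightarrow> real" where
  "opt_value f m r = real_of_ereal (INF x\<in>Collect (feasible f m). objective f r x)"

definition selection_rule :: "(nat \<Rightarrow> 'a \<Rightarrow> real) \<Rightarrow> nat \<Rightarrow> ('a \<Rightarrow> nat) \<Rightarrow> bool" where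
  "selection_rule f m sel \<longleftrightarrow>
     (\<forall>x. if feasible f m x then sel x = 0 else sel x \<in> {1..m} \<and> f (sel x) x > 0)"

text \<open>The function \<open>h\<^sub>y\<close>, with \<open>n\<close> the chosen subgradient of \<open>r\<close> at \<open>y\<close>.\<close>

definition lin_obj ::
  "(nat \<Rightarrow> 'a::euclidean_space \<Rightarrow> real) \<Rightarrow> ('a \<Rightarrow> ereal) \<Rightarrow> 'a \<Rightarrow> 'a \<Rightarrow> 'a \<Rightarrow> real" where
  "lin_obj f r y n x = f 0 x + real_of_ereal (r y) + n \<bullet> (x - y)"

text \<open>\<open>\<delta>\<^sub>k(y)\<close> is \<open>delta f m r sel y n\<^sub>y x\<^sub>k\<close>.\<close>

definition delta ::
  "(nat \<Rightarrow> 'a::euclidean_space \<Rightarrow> real) \<Rightarrow> nat \<Rightarrow> ('a \<Rightarrow> ereal) \<Rightarrow> ('a \<Rightarrow> nat) \<Rightarrow>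
    'a \<Rightarrow> 'a \<Rightarrow> 'a \<Rightarrow> real" where
  "delta f m r sel y n x =
     (if feasible f m x then lin_obj f r y n x - lin_obj f r y n y
      else f (sel x) x - f (sel x) y)"

text \<open>The supremum is \<open>-\<infinity>\<close> on the empty set, and \<open>\<infinity>\<close> if infinitely many stepsizes are
  large. In the latter case \<open>C_const\<close> is an infinite series; it is formed in \<^typ>\<open>ereal\<close>
  so that divergence gives \<open>\<infinity>\<close>.\<close>

definition T_const :: "real \<Rightarrow> (nat \<Rightarrow> real) \<Rightarrow> ereal" where
  "T_const L1 \<alpha> = (SUP k\<in>{k. L1 * \<alpha> k > 1}. ereal (real k))"

definition C_const ::
  "real \<Rightarrow> (nat \<Rightarrow> real) \<Rightarrow> (nat \<Rightarrow> real) \<Rightarrow> (nat \<Rightarrow> real) \<Rightarrow> (nat \<Rightarrow> real) \<Rightarrow> ereal" where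
  "C_const L1 \<alpha> lam d_opt d_sl =
     (\<Sum>\<^sub>\<infinity>k\<in>{k. ereal (real k) \<le> T_const L1 \<alpha>}.
        ereal (lam k * max (L1 * \<alpha> k - 1) 0 * max (d_opt k) (d_sl k)))"

text \<open>Below, \<open>X\<close> is one realization of the iterates and \<open>G k\<close> the realized oracle output
  \<open>g\<^sub>s(x\<^sub>k; \<xi>\<^sub>k)\<close> at \<open>s = s(x\<^sub>k)\<close>.\<close>

definition feasible_weight ::
  "('a \<Rightarrow> nat) \<Rightarrow> (nat \<Rightarrow> real) \<Rightarrow> (nat \<Rightarrow> 'a) \<Rightarrow> nat \<Rightarrow> real" where
  "feasible_weight sel lam X T = (\<Sum>k | k < T \<and> sel (X k) = 0. lam k)"

text \<open>\<open>prox_subgrad \<alpha> X G k\<close> is \<open>n\<^sub>k\<^sub>+\<^sub>1\<close>, and \<open>aggregate_model \<dots> T\<close> is the model built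
  from the iterates \<open>0, \<dots>, T - 1\<close>.\<close>

definition prox_subgrad ::
  "(nat \<Rightarrow> real) \<Rightarrow> (nat \<Rightarrow> 'a::euclidean_space) \<Rightarrow> (nat \<Rightarrow> 'a) \<Rightarrow> nat \<Rightarrow> 'a" where
  "prox_subgrad \<alpha> X G k = (1 / \<alpha> k) *\<^sub>R (X k - \<alpha> k *\<^sub>R G k - X (Suc k))"

definition aggregate_model ::
  "(nat \<Rightarrow> 'a::euclidean_space \<Rightarrow> real) \<Rightarrow> ('a \<Rightarrow> ereal) \<Rightarrow> ('a \<Rightarrow> nat) \<Rightarrow> real \<Rightarrow>
    (nat \<Rightarrow> real) \<Rightarrow> (nat \<Rightarrow> real) \<Rightarrow> (nat \<Rightarrow> 'a) \<Rightarrow> (nat \<Rightarrow> 'a) \<Rightarrow> nat \<Rightarrow> 'a \<Rightarrow> real" where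
  "aggregate_model f r sel \<mu> \<alpha> lam X G T x =
     (\<Sum>k<T. lam k *
        (f (sel (X k)) (X k) + G k \<bullet> (x - X k) + \<mu> / 2 * (norm (x - X k))\<^sup>2)) +
     (\<Sum>k | k < T \<and> sel (X k) = 0. lam k *
        (real_of_ereal (r (X (Suc k))) + prox_subgrad \<alpha> X G k \<bullet> (x - X (Suc k))))"

definition primal_gap ::
  "(nat \<Rightarrow> 'a::euclidean_space \<Rightarrow> real) \<Rightarrow> nat \<Rightarrow> ('a \<Rightarrow> ereal) \<Rightarrow> ('a \<Rightarrow> nat) \<Rightarrow>
    'a \<Rightarrow> 'a \<Rightarrow> (nat \<Rightarrow> real) \<Rightarrow> (nat \<Rightarrow> 'a) \<Rightarrow> nat \<Rightarrow> real" where
  "primal_gap f m r sel x_opt n_opt lam X T =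
     (\<Sum>k | k < T \<and> sel (X k) = 0. lam k * lin_obj f r x_opt n_opt (X k))
       / feasible_weight sel lam X T
     - opt_value f m r"

definition dual_gap ::
  "(nat \<Rightarrow> 'a::euclidean_space \<Rightarrow> real) \<Rightarrow> nat \<Rightarrow> ('a \<Rightarrow> ereal) \<Rightarrow> ('a \<Rightarrow> nat) \<Rightarrow> real \<Rightarrow>
    (nat \<Rightarrow> real) \<Rightarrow> (nat \<Rightarrow> real) \<Rightarrow> (nat \<Rightarrow> 'a) \<Rightarrow> (nat \<Rightarrow> 'a) \<Rightarrow> nat \<Rightarrow> real" where
  "dual_gap f m r sel \<mu> \<alpha> lam X G T =
     opt_value f m r
     - (INF x. aggregate_model f r sel \<mu> \<alpha> lam X G T x / feasible_weight sel lam X T)"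

end

theory Submission
  imports Defs
begin

text \<open>
  Write \<open>\<Lambda>\<close> for the total weight of the first \<open>T\<close> steps, \<open>M\<close> for the aggregate model, \<open>y\<close> for the
  minimizer and \<open>\<phi>\<^sub>k\<close> for the function that is active at \<open>x\<^sub>k\<close>: the objective with \<open>r\<close> linearized
  at \<open>y\<close> if \<open>x\<^sub>k\<close> is feasible, and the selected violated constraint otherwise; thus
  \<open>\<delta>\<^sub>k(y) = \<phi>\<^sub>k(x\<^sub>k) - \<phi>\<^sub>k(y)\<close>. Let \<open>b\<^sub>k\<close> be the chosen subgradient of \<open>r\<close> at \<open>y\<close> if \<open>x\<^sub>k\<close> is feasible,
  and \<open>0\<close> otherwise.

  The relation between stepsizes and weights is exactly the one that makes \<open>x\<^sub>T\<close> the minimizer of the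
  model: \<open>M x = M x\<^sub>T + \<mu>\<Lambda>/2 \<cdot> \<parallel>x - x\<^sub>T\<parallel>\<^sup>2\<close> (\<open>model_quadratic\<close>). Therefore the infimum in the dual gap is
  \<open>M x\<^sub>T\<close>, the optimal value cancels between the two gaps, and \<open>\<Lambda>\<close> times the random variable to be
  bounded is the weighted sum of the feasible values \<open>\<phi>\<^sub>k(x\<^sub>k)\<close> plus \<open>M y - 2 M x\<^sub>T\<close>. The two model values
  are estimated in opposite directions.

  \<^item> On every path, \<open>M x\<^sub>T\<close> is at least the weighted sum of
    \<open>\<phi>\<^sub>k(x\<^sub>k) - \<alpha>\<^sub>k/2 \<cdot> \<parallel>g\<^sub>k + b\<^sub>k\<parallel>\<^sup>2\<close> (\<open>model_min_ge\<close>), because each step raises the minimum of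
    the model by at least \<open>\<lambda>\<^sub>k\<close> times the minimum of a linear function plus \<open>\<parallel>\<cdot>\<parallel>\<^sup>2/(2\<alpha>\<^sub>k)\<close>.
  \<^item> In expectation, \<open>M y\<close> is at most the weighted sum of \<open>\<phi>\<^sub>k(y)\<close> (\<open>model_piece_expectation\<close>),
    because each cut is, on average over its own sample, a strongly convex minorant.

  The feasible values sum to at most the sum of all values since \<open>\<phi>\<^sub>k(x\<^sub>k) > 0\<close> at an infeasible
  iterate, and the second moment of \<open>g\<^sub>k + b\<^sub>k\<close> is at most \<open>L\<^sub>0\<^sup>2 + L\<^sub>1 \<delta>\<^sub>k\<close>. What remains is the weighted sum of
  \<open>\<alpha>\<^sub>k L\<^sub>0\<^sup>2 + (L\<^sub>1 \<alpha>\<^sub>k - 1) E \<delta>\<^sub>k\<close> (\<open>expected_gap_bound\<close>). As \<open>\<delta>\<^sub>k \<ge> 0\<close>, the terms with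
  \<open>L\<^sub>1 \<alpha>\<^sub>k \<le> 1\<close> may be dropped, and the others occur in the constant \<open>C\<^sub>0\<close>
  (\<open>partial_sum_le_C_const\<close>).

  All of these expectations must first be shown to be finite. The functions themselves may grow
  arbitrarily fast, but at an iterate the subgradient inequality bounds \<open>\<delta>\<^sub>k\<close> by the mean of
  \<open>g\<^sub>k + b\<^sub>k\<close> times \<open>x\<^sub>k - y\<close>, and the second moment of \<open>g\<^sub>k + b\<^sub>k\<close> is in turn bounded by \<open>\<delta>\<^sub>k\<close>. This
  closes to a quadratic bound of \<open>\<delta>\<^sub>k\<close> in \<open>\<parallel>x\<^sub>k - y\<parallel>\<close> (\<open>delta_le_quadratic\<close>), from which all iterates
  are square integrable by induction (\<open>square_integrable\<close>).
\<close>

section \<open>Subgradients and the proximal map\<close>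

lemma subdiff_finite:
  assumes "proper_closed_convex r" "n \<in> subdiff r x"
  shows "\<bar>r x\<bar> \<noteq> \<infinity>"
proof -
  obtain y where y: "r y \<noteq> \<infinity>" using assms(1) by (auto simp: proper_closed_convex_def)
  have "r x + ereal (n \<bullet> (y - x)) \<le> r y" using assms(2) by (auto simp: subdiff_def)
  then have "r x \<noteq> \<infinity>" using y by auto
  moreover have "r x \<noteq> -\<infinity>" using assms(1) by (auto simp: proper_closed_convex_def)
  ultimately show ?thesis by auto
qed

lemma subdiff_real_le:
  assumes "proper_closed_convex r" "n \<in> subdiff r x" "n' \<in> subdiff r y"
  shows "real_of_ereal (r x) + n \<bullet> (y - x) \<le> real_of_ereal (r y)"
proof -
  have "r x + ereal (n \<bullet> (y - x)) \<le> r y" using assms(2) by (auto simp: subdiff_def)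
  moreover obtain a b where "r x = ereal a" "r y = ereal b"
    using subdiff_finite[OF assms(1,2)] subdiff_finite[OF assms(1,3)] by auto
  ultimately show ?thesis by simp
qed

text \<open>Completing the square. This is Young's inequality in the form in which a quadratic absorbs a
  linear term; it serves for coercivity, for the decrease in one step, and for the growth of \<open>\<delta>\<close>.\<close>

lemma inner_plus_quadratic_ge:
  fixes u v :: "'a::real_inner"
  assumes "a > 0"
  shows "- (a * (norm v)\<^sup>2) \<le> v \<bullet> u + 1 / (4 * a) * (norm u)\<^sup>2"
proof -
  have "0 \<le> a * (norm (v + (1 / (2 * a)) *\<^sub>R u))\<^sup>2" using assms by simp
  also have "\<dots> = a * (norm v)\<^sup>2 + v \<bullet> u + 1 / (4 * a) * (norm u)\<^sup>2"
    using assms unfolding power2_norm_eq_inner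
    by (simp add: inner_add_left inner_add_right inner_commute field_simps)
  finally show ?thesis by (simp add: field_simps)
qed

text \<open>A subgradient at any point supplies an affine minorant of \<open>r\<close>, which makes the regularized
  function coercive. Lower semicontinuity is available only as closedness of the epigraph, so
  the minimum is attained by minimizing the continuous function \<open>(x, t) \<mapsto> t + q x\<close> over a compact piece of
  the epigraph.\<close>

lemma prox_is_arg_min:
  assumes r: "proper_closed_convex r" and n: "n \<in> subdiff r y" and a: "a > 0"
  shows "is_arg_min (\<lambda>x. r x + ereal (1 / (2 * a) * (norm (x - z))\<^sup>2)) (\<lambda>_. True) (prox a r z)"
proof -
  define q where "q x = 1 / (2 * a) * (norm (x - z))\<^sup>2" for x
  obtain c where c: "r y = ereal c" using subdiff_finite[OF r n] by auto
  \<comment> \<open>Points of \<open>K\<close> are those at least as good as \<open>(y, c)\<close>, so its minimizer is global.\<close>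
  define K where "K = ereal_epigraph r \<inter> {p. snd p + q (fst p) \<le> c + q y}"
  have contq: "continuous_on UNIV (\<lambda>p::'a \<times> real. snd p + q (fst p))"
    unfolding q_def by (intro continuous_intros)
  have lower: "c + n \<bullet> (x - y) \<le> t" if "(x, t) \<in> ereal_epigraph r" for x t
  proof -
    have "r y + ereal (n \<bullet> (x - y)) \<le> r x" using n by (auto simp: subdiff_def)
    also have "\<dots> \<le> ereal t" using that by (simp add: ereal_epigraph_def)
    finally show ?thesis using c by simp
  qed
  have "closed K" unfolding K_def
    using r contq by (auto simp: proper_closed_convex_def intro!: closed_Int closed_Collect_le continuous_on_const)
  moreover have "bounded K"
  proof -
    define R where "R = 4 * a * (q y + a * (norm n)\<^sup>2 - n \<bullet> (z - y))"
    have bx: "(norm (x - z))\<^sup>2 \<le> R" if "(x, t) \<in> K" for x t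
    proof -
      have "c + n \<bullet> (x - y) + q x \<le> c + q y"
        using lower[of x t] that by (auto simp: K_def)
      moreover have "n \<bullet> (x - y) = n \<bullet> (x - z) + n \<bullet> (z - y)" by (simp add: inner_diff_right)
      ultimately have "1 / (4 * a) * (norm (x - z))\<^sup>2 \<le> q y + a * (norm n)\<^sup>2 - n \<bullet> (z - y)"
        using inner_plus_quadratic_ge[OF a, of n "x - z"] by (simp add: q_def field_simps)
      then show ?thesis using a by (simp add: R_def field_simps)
    qed
    have "K \<subseteq> cball z (sqrt R) \<times> {c - norm n * (sqrt R + norm (z - y)) .. c + q y}"
    proof
      fix p assume p: "p \<in> K"
      obtain x t where pp: "p = (x, t)" by (cases p)
      have nx: "norm (x - z) \<le> sqrt R"
        using bx p pp by (metis real_le_rsqrt)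
      have "c - norm n * norm (x - y) \<le> c + n \<bullet> (x - y)"
        using Cauchy_Schwarz_ineq2[of n "x - y"] by linarith
      moreover have "norm (x - y) \<le> sqrt R + norm (z - y)"
        using norm_triangle_ineq[of "x - z" "z - y"] nx by simp
      ultimately have "c - norm n * (sqrt R + norm (z - y)) \<le> t"
        using lower[of x t] p pp mult_left_mono[of "norm (x - y)" "sqrt R + norm (z - y)" "norm n"]
        by (auto simp: K_def)
      moreover have "t \<le> c + q y"
        using p pp a by (auto simp: K_def q_def) (smt (verit) divide_nonneg_pos zero_le_power2)
      ultimately show "p \<in> cball z (sqrt R) \<times> {c - norm n * (sqrt R + norm (z - y)) .. c + q y}"
        using nx pp by (auto simp: dist_norm norm_minus_commute)
    qed
    moreover have "bounded (cball z (sqrt R) \<times> {c - norm n * (sqrt R + norm (z - y)) .. c + q y})"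
      by (intro bounded_Times bounded_cball bounded_closed_interval)
    ultimately show ?thesis by (rule bounded_subset[rotated])
  qed
  ultimately have "compact K" by (simp add: compact_eq_bounded_closed)
  moreover have yK: "(y, c) \<in> K" using c by (simp add: K_def ereal_epigraph_def)
  ultimately obtain p where p: "p \<in> K" and pmin: "\<And>p'. p' \<in> K \<Longrightarrow> snd p + q (fst p) \<le> snd p' + q (fst p')"
    using continuous_attains_inf[of K "\<lambda>p. snd p + q (fst p)"] continuous_on_subset[OF contq] by blast
  have "r (fst p) + ereal (q (fst p)) \<le> r x + ereal (q x)" for x
  proof (cases "r x")
    case (real t)
    have "snd p + q (fst p) \<le> t + q x"
    proof (cases "(x, t) \<in> K")
      case False
      then have "t + q x > c + q y" using real by (auto simp: K_def ereal_epigraph_def)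
      then show ?thesis using pmin[OF yK] by simp
    qed (use pmin in force)
    moreover have "r (fst p) \<le> ereal (snd p)"
      using p by (auto simp: K_def ereal_epigraph_def)
    ultimately have "r (fst p) + ereal (q (fst p)) \<le> ereal (t + q x)"
      by (metis add_right_mono ereal_less_eq(3) order_trans plus_ereal.simps(1))
    then show ?thesis using real by simp
  qed (use r in \<open>auto simp: proper_closed_convex_def\<close>)
  then have "is_arg_min (\<lambda>x. r x + ereal (q x)) (\<lambda>_. True) (fst p)"
    by (auto simp: is_arg_min_def not_less)
  then show ?thesis
    unfolding prox_def arg_min_def q_def by (rule someI)
qed

text \<open>The limit \<open>t \<longrightarrow> 0\<close> in a first-order optimality argument along a segment.\<close>

lemma affine_slope_le:
  fixes A B C :: real
  assumes "\<And>t. 0 < t \<Longrightarrow> t < 1 \<Longrightarrow> A \<le> B + t * C"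
  shows "A \<le> B"
proof -
  have "((\<lambda>t. B + t * C) \<longlongrightarrow> B + 0 * C) (at_right 0)" by (intro tendsto_intros)
  moreover have "\<forall>\<^sub>F t in at_right 0. A \<le> B + t * C"
    using assms by (auto simp: eventually_at_right[of 0 1] intro!: exI[of _ 1])
  ultimately show ?thesis
    using tendsto_lowerbound[of "\<lambda>t. B + t * C" B "at_right 0" A] by simp
qed

text \<open>The optimality condition of the proximal problem: compare the minimizer \<open>p\<close> with the points of
  the segment from \<open>p\<close> to \<open>x\<close>, bound \<open>r\<close> there by convexity, divide by the length parameter and let
  it tend to \<open>0\<close>.\<close>

lemma prox_subdiff:
  assumes r: "proper_closed_convex r" and n: "n \<in> subdiff r y" and a: "a > 0"
  shows "(1 / a) *\<^sub>R (z - prox a r z) \<in> subdiff r (prox a r z)"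
proof -
  define p where "p = prox a r z"
  have pm: "r p + ereal (1 / (2 * a) * (norm (p - z))\<^sup>2) \<le> r x + ereal (1 / (2 * a) * (norm (x - z))\<^sup>2)" for x
    using prox_is_arg_min[OF r n a, of z] by (auto simp: is_arg_min_def not_less p_def)
  obtain c where c: "r y = ereal c" using subdiff_finite[OF r n] by auto
  have "r p \<noteq> \<infinity>" using pm[of y] c by auto
  then obtain s where s: "r p = ereal s" using r by (cases "r p") (auto simp: proper_closed_convex_def)
  have "r p + ereal (((1 / a) *\<^sub>R (z - p)) \<bullet> (x - p)) \<le> r x" for x
  proof (cases "r x")
    case (real t)
    have "(1 / a) * ((z - p) \<bullet> (x - p)) \<le> (t - s) + \<tau> * (1 / (2 * a) * (norm (x - p))\<^sup>2)"
      if \<tau>: "0 < \<tau>" "\<tau> < 1" for \<tau>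
    proof -
      define w where "w = (1 - \<tau>) *\<^sub>R p + \<tau> *\<^sub>R x"
      define h where "h = 1 / (2 * a)"
      have ha: "1 / a = 2 * h" by (simp add: h_def)
      have "(1 - \<tau>) *\<^sub>R (p, s) + \<tau> *\<^sub>R (x, t) \<in> ereal_epigraph r"
        using r \<tau> s real unfolding proper_closed_convex_def convex_alt ereal_epigraph_def by auto
      then have rw: "r w \<le> ereal ((1 - \<tau>) * s + \<tau> * t)" by (simp add: ereal_epigraph_def w_def)
      then have "ereal (s + 1 / (2 * a) * (norm (p - z))\<^sup>2)
          \<le> ereal ((1 - \<tau>) * s + \<tau> * t + 1 / (2 * a) * (norm (w - z))\<^sup>2)"
        using order_trans[OF pm[of w] add_right_mono[OF rw]] s by simp
      then have 1: "s + 1 / (2 * a) * (norm (p - z))\<^sup>2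
          \<le> (1 - \<tau>) * s + \<tau> * t + 1 / (2 * a) * (norm (w - z))\<^sup>2" by simp
      have wz: "w - z = (p - z) + \<tau> *\<^sub>R (x - p)" by (simp add: w_def algebra_simps)
      have 2: "(norm (w - z))\<^sup>2 = (norm (p - z))\<^sup>2 - 2 * \<tau> * ((z - p) \<bullet> (x - p)) + \<tau>\<^sup>2 * (norm (x - p))\<^sup>2"
        unfolding power2_norm_eq_inner wz
        by (simp add: inner_add_left inner_add_right inner_diff_left inner_diff_right inner_commute
            algebra_simps power2_eq_square)
      have "\<tau> * ((1 / a) * ((z - p) \<bullet> (x - p))) \<le> \<tau> * ((t - s) + \<tau> * (1 / (2 * a) * (norm (x - p))\<^sup>2))"
        using 1 unfolding 2 h_def[symmetric] ha by (simp add: algebra_simps power2_eq_square)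
      then show ?thesis using \<tau>(1) by (rule mult_left_le_imp_le)
    qed
    then have "(1 / a) * ((z - p) \<bullet> (x - p)) \<le> t - s" by (rule affine_slope_le)
    then show ?thesis using real s by simp
  qed (use r in \<open>auto simp: proper_closed_convex_def\<close>)
  then show ?thesis by (auto simp: subdiff_def p_def)
qed

text \<open>Monotonicity of the subdifferential. It is stated for points satisfying the resolvent inclusion,
  so that it also applies to \<open>p' = y\<close> with \<open>z' = y + a n\<close> for any \<open>n \<in> subdiff r y\<close>.\<close>

lemma resolvent_nonexpansive:
  assumes r: "proper_closed_convex r" and a: "a > 0"
    and p: "(1 / a) *\<^sub>R (z - p) \<in> subdiff r p" and p': "(1 / a) *\<^sub>R (z' - p') \<in> subdiff r p'"
  shows "norm (p - p') \<le> norm (z - z')"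
proof -
  have "(1 / a) * ((z - p) \<bullet> (p' - p)) + (1 / a) * ((z' - p') \<bullet> (p - p')) \<le> 0"
    using subdiff_real_le[OF r p p'] subdiff_real_le[OF r p' p] by simp
  then have "(1 / a) * ((z - p) \<bullet> (p' - p) + (z' - p') \<bullet> (p - p')) \<le> 0"
    by (simp only: distrib_left)
  then have "(z - p) \<bullet> (p' - p) + (z' - p') \<bullet> (p - p') \<le> 0"
    using a by (simp add: field_simps)
  then have "(norm (p - p'))\<^sup>2 \<le> (z - z') \<bullet> (p - p')"
    unfolding power2_norm_eq_inner by (simp add: inner_diff_left inner_diff_right inner_commute)
  also have "\<dots> \<le> norm (z - z') * norm (p - p')" by (rule norm_cauchy_schwarz)
  finally show ?thesis
    by (cases "p = p'") (auto simp: power2_eq_square)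
qed

lemma continuous_on_prox:
  assumes r: "proper_closed_convex r" and n: "n \<in> subdiff r y" and a: "a > 0"
  shows "continuous_on UNIV (prox a r)"
proof (rule continuous_on_iff[THEN iffD2], intro ballI allI impI)
  fix z and e :: real assume "e > 0"
  then show "\<exists>d>0. \<forall>z'\<in>UNIV. dist z' z < d \<longrightarrow> dist (prox a r z') (prox a r z) < e"
    using resolvent_nonexpansive[OF r a prox_subdiff[OF r n a] prox_subdiff[OF r n a]]
    by (intro exI[of _ e]) (auto simp: dist_norm intro: le_less_trans)
qed

lemma strongly_convex_continuous:
  assumes "strongly_convex \<mu> f"
  shows "continuous_on UNIV f"
proof -
  have "continuous_on UNIV (\<lambda>x. (f x - \<mu> / 2 * (norm x)\<^sup>2) + \<mu> / 2 * (norm x)\<^sup>2)"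
    using assms unfolding strongly_convex_def
    by (intro continuous_on_add[OF convex_on_continuous[OF open_UNIV]] continuous_intros)
  then show ?thesis by simp
qed

text \<open>A subgradient of a strongly convex function yields a quadratic minorant of full curvature: on a
  segment of parameter \<open>t\<close> strong convexity gains \<open>t (1 - t) \<mu>/2\<close> times the squared length, and dividing by
  \<open>t\<close> leaves \<open>\<mu>/2\<close> in the limit.\<close>

lemma strongly_convex_subgradient:
  assumes f: "strongly_convex \<mu> f" and v: "v \<in> subdiff (\<lambda>x. ereal (f x)) u"
  shows "f u + v \<bullet> (x - u) + \<mu> / 2 * (norm (x - u))\<^sup>2 \<le> f x"
proof -
  have "v \<bullet> (x - u) + \<mu> / 2 * (norm (x - u))\<^sup>2 \<le> f x - f u + t * (\<mu> / 2 * (norm (x - u))\<^sup>2)"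
    if t: "0 < t" "t < 1" for t
  proof -
    define w where "w = (1 - t) *\<^sub>R u + t *\<^sub>R x"
    define h where "h = \<mu> / 2"
    have 1: "f w - \<mu> / 2 * (norm w)\<^sup>2 \<le> (1 - t) * (f u - \<mu> / 2 * (norm u)\<^sup>2) + t * (f x - \<mu> / 2 * (norm x)\<^sup>2)"
      using f t unfolding strongly_convex_def convex_on_def w_def by auto
    have "f u + v \<bullet> (w - u) \<le> f w" using v by (auto simp: subdiff_def)
    moreover have "w - u = t *\<^sub>R (x - u)" by (simp add: w_def algebra_simps)
    ultimately have 2: "f u + t * (v \<bullet> (x - u)) \<le> f w" by simp
    have 3: "(norm w)\<^sup>2 = (1 - t) * (norm u)\<^sup>2 + t * (norm x)\<^sup>2 - t * (1 - t) * (norm (x - u))\<^sup>2"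
      unfolding w_def power2_norm_eq_inner
      by (simp add: inner_add_left inner_add_right inner_diff_left inner_diff_right inner_commute algebra_simps)
    have "t * (v \<bullet> (x - u) + \<mu> / 2 * (norm (x - u))\<^sup>2) \<le> t * (f x - f u + t * (\<mu> / 2 * (norm (x - u))\<^sup>2))"
      using 1 2 unfolding 3 h_def[symmetric] by (simp add: algebra_simps)
    then show ?thesis using t(1) by (rule mult_left_le_imp_le)
  qed
  then have "v \<bullet> (x - u) + \<mu> / 2 * (norm (x - u))\<^sup>2 \<le> f x - f u" by (rule affine_slope_le)
  then show ?thesis by simp
qed

lemma proper_closed_convex_measurable:
  assumes "proper_closed_convex r"
  shows "r \<in> borel_measurable borel"
proof (rule borel_measurableI_le)
  fix c :: ereal
  have cl: "closed {x. r x \<le> ereal t}" for t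
  proof -
    have "{x. r x \<le> ereal t} = (\<lambda>x. (x, t)) -` ereal_epigraph r" by (auto simp: ereal_epigraph_def)
    moreover have "closed ((\<lambda>x. (x, t)) -` ereal_epigraph r)"
      using assms by (intro continuous_closed_vimage) (auto simp: proper_closed_convex_def)
    ultimately show ?thesis by simp
  qed
  show "{x \<in> space borel. r x \<le> c} \<in> sets borel"
  proof (cases c)
    case (real t) then show ?thesis using cl by simp
  next
    case PInf then show ?thesis by simp
  next
    case MInf
    then have "{x. r x \<le> c} = {}" using assms by (auto simp: proper_closed_convex_def)
    then show ?thesis by simp
  qed
qed

section \<open>The aggregate model along one path\<close>

text \<open>The aggregate model splits into one summand per step; at a feasible iterate the cut of \<open>r\<close> taken
  at the next iterate is counted with that step.\<close>

definition model_piece where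
  "model_piece f r sel \<mu> \<alpha> X G k x =
     f (sel (X k)) (X k) + G k \<bullet> (x - X k) + \<mu> / 2 * (norm (x - X k))\<^sup>2 +
     (if sel (X k) = 0
      then real_of_ereal (r (X (Suc k))) + prox_subgrad \<alpha> X G k \<bullet> (x - X (Suc k)) else 0)"

lemma sum_if_less:
  fixes w :: "nat \<Rightarrow> real"
  shows "(\<Sum>k | k < T \<and> Q k. w k) = (\<Sum>k<T. if Q k then w k else 0)"
proof -
  have "{k. k < T \<and> Q k} = {k \<in> {..<T}. Q k}" by auto
  then show ?thesis using sum.inter_filter[of "{..<T}" w Q] by simp
qed

lemma aggregate_model_eq_sum:
  "aggregate_model f r sel \<mu> \<alpha> lam X G T x = (\<Sum>k<T. lam k * model_piece f r sel \<mu> \<alpha> X G k x)"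
  unfolding aggregate_model_def model_piece_def sum_if_less sum.distrib[symmetric]
  by (intro sum.cong) (auto simp: algebra_simps)

text \<open>The deterministic part of the analysis concerns a single realization. At an infeasible iterate
  the step is prescribed; at a feasible one the definition of \<open>prox_subgrad\<close> encodes its form.\<close>

locale weighted_path =
  fixes f :: "nat \<Rightarrow> 'a::euclidean_space \<Rightarrow> real" and r :: "'a \<Rightarrow> ereal" and sel :: "'a \<Rightarrow> nat"
    and \<mu> :: real and \<alpha> lam :: "nat \<Rightarrow> real" and X G :: "nat \<Rightarrow> 'a"
  assumes mu_pos: "\<mu> > 0"
    and lam_pos: "lam k > 0"
    and alpha: "\<alpha> k = lam k / (\<mu> * (\<Sum>i\<le>k. lam i))"
    and violated_step: "sel (X k) \<noteq> 0 \<Longrightarrow> X (Suc k) = X k - \<alpha> k *\<^sub>R G k"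
begin

abbreviation "piece \<equiv> model_piece f r sel \<mu> \<alpha> X G"
abbreviation "model \<equiv> aggregate_model f r sel \<mu> \<alpha> lam X G"
abbreviation "Lam T \<equiv> (\<Sum>k<T. lam k)"

lemma Lam_pos: "T > 0 \<Longrightarrow> Lam T > 0"
  using lam_pos by (intro sum_pos) auto

text \<open>The stepsize rule solved for the weight: \<open>\<lambda>\<^sub>k/\<alpha>\<^sub>k\<close> is the curvature of the model after step \<open>k\<close>.\<close>

lemma lam_eq: "lam k = \<mu> * \<alpha> k * Lam (Suc k)"
  using Lam_pos[of "Suc k"] mu_pos by (simp add: alpha lessThan_Suc_atMost)

lemma alpha_pos: "\<alpha> k > 0"
  using lam_pos[of k] Lam_pos[of "Suc k"] mu_pos by (simp add: alpha lessThan_Suc_atMost)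

text \<open>Every step has the form \<open>x\<^sub>k - x\<^sub>k\<^sub>+\<^sub>1 = \<alpha>\<^sub>k (g\<^sub>k + n\<^sub>k\<^sub>+\<^sub>1)\<close>, where \<open>n\<^sub>k\<^sub>+\<^sub>1 = 0\<close> after an infeasible iterate. The
  slope of the new summand is therefore determined by the step itself, and feasible and infeasible
  iterates can be treated alike.\<close>

lemma piece_diff:
  "piece k x - piece k v = (1 / \<alpha> k) * ((X k - X (Suc k)) \<bullet> (x - v))
     + \<mu> / 2 * ((norm (x - X k))\<^sup>2 - (norm (v - X k))\<^sup>2)"
proof -
  have "(1 / \<alpha> k) *\<^sub>R (X k - X (Suc k)) = G k + prox_subgrad \<alpha> X G k"
    using alpha_pos[of k] by (simp add: prox_subgrad_def scaleR_diff_right)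
  then have "(1 / \<alpha> k) * ((X k - X (Suc k)) \<bullet> (x - v)) = (G k + prox_subgrad \<alpha> X G k) \<bullet> (x - v)"
    by (metis inner_scaleR_left)
  moreover have "sel (X k) \<noteq> 0 \<Longrightarrow> prox_subgrad \<alpha> X G k = 0"
    using violated_step[of k] by (simp add: prox_subgrad_def)
  ultimately show ?thesis
    by (auto simp: model_piece_def inner_add_left inner_diff_right algebra_simps)
qed

text \<open>The iterate is the minimizer of the model built so far. In the induction step the slope of the
  new summand, scaled by its weight, is \<open>\<mu>\<Lambda>\<close> times the displacement, which is exactly what moves the
  centre of the quadratic from \<open>x\<^sub>T\<close> to \<open>x\<^sub>T\<^sub>+\<^sub>1\<close>.\<close>

lemma model_quadratic:
  "model T x = model T (X T) + \<mu> / 2 * Lam T * (norm (x - X T))\<^sup>2"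
proof (induction T arbitrary: x)
  case 0 show ?case by (simp add: aggregate_model_eq_sum)
next
  case (Suc T)
  define v where "v = X (Suc T)"
  have nx: "(norm (x - X T))\<^sup>2 - (norm (v - X T))\<^sup>2 = (norm (x - v))\<^sup>2 - 2 * ((X T - v) \<bullet> (x - v))"
    unfolding power2_norm_eq_inner by (simp add: inner_diff_left inner_diff_right inner_commute)
  have "model (Suc T) x - model (Suc T) v
      = (model T x - model T v) + lam T * (piece T x - piece T v)"
    by (simp add: aggregate_model_eq_sum right_diff_distrib)
  also have "model T x - model T v = \<mu> / 2 * Lam T * ((norm (x - X T))\<^sup>2 - (norm (v - X T))\<^sup>2)"
    by (subst (1 2) Suc.IH) (simp add: algebra_simps)
  also have "lam T * (piece T x - piece T v) = \<mu> * Lam (Suc T) * ((X T - v) \<bullet> (x - v))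
      + \<mu> / 2 * lam T * ((norm (x - X T))\<^sup>2 - (norm (v - X T))\<^sup>2)"
  proof -
    have "lam T * (1 / \<alpha> T) = \<mu> * Lam (Suc T)"
      using alpha_pos[of T] lam_eq[of T] by (simp add: field_simps)
    then show ?thesis unfolding piece_diff v_def[symmetric] distrib_left mult.assoc[symmetric]
      by (simp only: mult.assoc mult.commute mult.left_commute)
  qed
  finally have "model (Suc T) x - model (Suc T) v = \<mu> / 2 * Lam (Suc T) * (norm (x - v))\<^sup>2"
    unfolding nx by (simp add: algebra_simps)
  then show ?case by (simp add: v_def)
qed

text \<open>Evaluate the new model at its own minimizer. The curvature accumulated before the step and the
  curvature of the new summand add up to \<open>\<lambda>\<^sub>T/\<alpha>\<^sub>T\<close>, so the increment of the minimum is \<open>\<lambda>\<^sub>T\<close> times the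
  value of a proximal problem with stepsize \<open>\<alpha>\<^sub>T\<close>.\<close>

lemma model_min_Suc:
  "model (Suc T) (X (Suc T)) = model T (X T) + lam T *
     (f (sel (X T)) (X T) + G T \<bullet> (X (Suc T) - X T) + 1 / (2 * \<alpha> T) * (norm (X (Suc T) - X T))\<^sup>2
      + (if sel (X T) = 0 then real_of_ereal (r (X (Suc T))) else 0))"
proof -
  have "model (Suc T) (X (Suc T)) = model T (X (Suc T)) + lam T * piece T (X (Suc T))"
    by (simp add: aggregate_model_eq_sum)
  moreover have "lam T * (1 / (2 * \<alpha> T)) = \<mu> / 2 * Lam T + lam T * (\<mu> / 2)"
    using alpha_pos[of T] by (subst lam_eq) (simp add: field_simps)
  then have "lam T * (1 / (2 * \<alpha> T) * (norm (X (Suc T) - X T))\<^sup>2)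
      = (\<mu> / 2 * Lam T + lam T * (\<mu> / 2)) * (norm (X (Suc T) - X T))\<^sup>2"
    by (simp only: mult.assoc[symmetric])
  ultimately show ?thesis
    by (subst (asm) model_quadratic) (simp add: model_piece_def algebra_simps)
qed

text \<open>Replacing \<open>r x\<^sub>k\<^sub>+\<^sub>1\<close> by the linear minorant of \<open>r\<close> at \<open>y\<close> turns the increment of the minimum into a
  linear plus a quadratic function of the displacement, whose least value is
  \<open>- \<alpha>\<^sub>k/2\<close> times the squared slope. The minorant at \<open>y\<close>, rather than the cut actually taken, is what lets
  the bound be phrased in terms of \<open>g\<^sub>k + n\<close>.\<close>

lemma model_min_ge:
  assumes r: "proper_closed_convex r" and n: "n \<in> subdiff r y"
    and prox_step: "\<And>k. sel (X k) = 0 \<Longrightarrow> prox_subgrad \<alpha> X G k \<in> subdiff r (X (Suc k))"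
  shows "model T (X T) \<ge> (\<Sum>k<T. lam k *
    ((if sel (X k) = 0 then lin_obj f r y n (X k) else f (sel (X k)) (X k))
      - \<alpha> k / 2 * (norm (G k + (if sel (X k) = 0 then n else 0)))\<^sup>2))"
proof (induction T)
  case 0 show ?case by (simp add: aggregate_model_eq_sum)
next
  case (Suc T)
  define d where "d = X (Suc T) - X T"
  define b where "b = (if sel (X T) = 0 then n else 0)"
  have "- (\<alpha> T / 2 * (norm (G T + b))\<^sup>2) \<le> (G T + b) \<bullet> d + 1 / (2 * \<alpha> T) * (norm d)\<^sup>2"
    using inner_plus_quadratic_ge[of "\<alpha> T / 2" "G T + b" d] alpha_pos[of T] by simp
  moreover have "real_of_ereal (r y) + n \<bullet> (X T - y) + n \<bullet> d \<le> real_of_ereal (r (X (Suc T)))"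
    if "sel (X T) = 0"
    using subdiff_real_le[OF r n prox_step[OF that]] by (simp add: d_def inner_diff_right)
  ultimately have "(if sel (X T) = 0 then lin_obj f r y n (X T) else f (sel (X T)) (X T))
      - \<alpha> T / 2 * (norm (G T + b))\<^sup>2
    \<le> f (sel (X T)) (X T) + G T \<bullet> d + 1 / (2 * \<alpha> T) * (norm d)\<^sup>2
      + (if sel (X T) = 0 then real_of_ereal (r (X (Suc T))) else 0)"
    by (auto simp: lin_obj_def b_def inner_add_left)
  from mult_left_mono[OF this less_imp_le[OF lam_pos[of T]]] Suc.IH
  show ?case by (simp add: model_min_Suc d_def b_def)
qed

end

section \<open>The method as a Markov chain driven by independent samples\<close>

lemma norm_add_sq_le: "(norm (u + v))\<^sup>2 \<le> 2 * (norm u)\<^sup>2 + 2 * (norm (v::'a::real_inner))\<^sup>2"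
proof -
  have "0 \<le> (norm (u - v))\<^sup>2" by simp
  moreover have "(norm (u + v))\<^sup>2 + (norm (u - v))\<^sup>2 = 2 * (norm u)\<^sup>2 + 2 * (norm v)\<^sup>2"
    unfolding power2_norm_eq_inner
    by (simp add: inner_add_left inner_add_right inner_diff_left inner_diff_right)
  ultimately show ?thesis by linarith
qed

lemma abs_inner_le_sq: "\<bar>u \<bullet> v\<bar> \<le> (norm u)\<^sup>2 + (norm (v::'a::real_inner))\<^sup>2"
proof -
  have "\<bar>u \<bullet> v\<bar> \<le> norm u * norm v" by (rule Cauchy_Schwarz_ineq2)
  also have "\<dots> \<le> (norm u)\<^sup>2 + (norm v)\<^sup>2"
    using zero_le_power2[of "norm u - norm v"] mult_nonneg_nonneg[OF norm_ge_zero[of u] norm_ge_zero[of v]]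
    unfolding power2_diff by linarith
  finally show ?thesis .
qed

lemma integrable_inner:
  fixes U V :: "'w \<Rightarrow> 'a::euclidean_space"
  assumes [measurable]: "U \<in> borel_measurable M" "V \<in> borel_measurable M"
    and "integrable M (\<lambda>\<omega>. (norm (U \<omega>))\<^sup>2)" "integrable M (\<lambda>\<omega>. (norm (V \<omega>))\<^sup>2)"
  shows "integrable M (\<lambda>\<omega>. U \<omega> \<bullet> V \<omega>)"
proof (rule Bochner_Integration.integrable_bound)
  show "integrable M (\<lambda>\<omega>. (norm (U \<omega>))\<^sup>2 + (norm (V \<omega>))\<^sup>2)" using assms by simp
  show "AE \<omega> in M. norm (U \<omega> \<bullet> V \<omega>) \<le> norm ((norm (U \<omega>))\<^sup>2 + (norm (V \<omega>))\<^sup>2)"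
    by (intro AE_I2) (auto intro!: order_trans[OF abs_inner_le_sq])
qed measurable

text \<open>The probabilistic setting relative to one reference point \<open>y\<close>, which is a minimizer of the
  linearized objective over the feasible set; \<open>n\<close> is the subgradient of \<open>r\<close> used in the linearization.\<close>

locale switching_method = prob_space P for P :: "'w measure" +
  fixes f :: "nat \<Rightarrow> 'a::euclidean_space \<Rightarrow> real" and m :: nat and r :: "'a \<Rightarrow> ereal"
    and sel :: "'a \<Rightarrow> nat" and g :: "nat \<Rightarrow> 'a \<Rightarrow> 'z \<Rightarrow> 'a" and D :: "'z measure"
    and \<xi> :: "nat \<Rightarrow> 'w \<Rightarrow> 'z" and X G :: "'w \<Rightarrow> nat \<Rightarrow> 'a"
    and x0 y n :: 'a and \<mu> L0 L1 :: real and \<alpha> lam :: "nat \<Rightarrow> real"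
  assumes r: "proper_closed_convex r"
    and sel: "selection_rule f m sel" and sel_borel: "sel \<in> borel \<rightarrow>\<^sub>M count_space UNIV"
    and indep: "indep_vars (\<lambda>_. D) \<xi> UNIV" and ident: "distr P D (\<xi> k) = D"
    and g_borel: "i \<le> m \<Longrightarrow> (\<lambda>(u, z). g i u z) \<in> borel_measurable (borel \<Otimes>\<^sub>M D)"
    and g_integrable: "i \<le> m \<Longrightarrow> integrable D (g i u)"
    and g_unbiased: "i \<le> m \<Longrightarrow> (\<integral>z. g i u z \<partial>D) \<in> subdiff (\<lambda>v. ereal (f i v)) u"
    and init: "\<omega> \<in> space P \<Longrightarrow> X \<omega> 0 = x0"
    and step: "\<omega> \<in> space P \<Longrightarrow> X \<omega> (Suc k) =
      (if feasible f m (X \<omega> k)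
       then prox (\<alpha> k) r (X \<omega> k - \<alpha> k *\<^sub>R g 0 (X \<omega> k) (\<xi> k \<omega>))
       else X \<omega> k - \<alpha> k *\<^sub>R g (sel (X \<omega> k)) (X \<omega> k) (\<xi> k \<omega>))"
    and out: "\<omega> \<in> space P \<Longrightarrow> G \<omega> k = g (sel (X \<omega> k)) (X \<omega> k) (\<xi> k \<omega>)"
    and mu_pos: "\<mu> > 0" and strong: "i \<le> m \<Longrightarrow> strongly_convex \<mu> (f i)"
    and feasible_y: "feasible f m y"
    and n_subdiff: "n \<in> subdiff r y"
    and y_minimal: "is_arg_min (lin_obj f r y n) (feasible f m) y"
    and L1_nonneg: "L1 \<ge> 0"
    and moment: "AE \<omega> in P. \<forall>k.
        (feasible f m (X \<omega> k) \<longrightarrow>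
           integrable D (\<lambda>z. (norm (g 0 (X \<omega> k) z + n))\<^sup>2) \<and>
           (\<integral>z. (norm (g 0 (X \<omega> k) z + n))\<^sup>2 \<partial>D)
             \<le> L0\<^sup>2 + L1 * delta f m r sel y n (X \<omega> k)) \<and>
        (\<not> feasible f m (X \<omega> k) \<longrightarrow>
           integrable D (\<lambda>z. (norm (g (sel (X \<omega> k)) (X \<omega> k) z))\<^sup>2) \<and>
           (\<integral>z. (norm (g (sel (X \<omega> k)) (X \<omega> k) z))\<^sup>2 \<partial>D)
             \<le> L0\<^sup>2 + L1 * delta f m r sel y n (X \<omega> k))"
    and lam_pos: "lam k > 0"
    and alpha: "\<alpha> k = lam k / (\<mu> * (\<Sum>i\<le>k. lam i))"
begin

text \<open>\<open>active x\<^sub>k\<close> is the function \<open>\<phi>\<^sub>k\<close> of the introduction.\<close>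

definition active :: "'a \<Rightarrow> 'a \<Rightarrow> real" where
  "active u v = (if sel u = 0 then lin_obj f r y n v else f (sel u) v)"

text \<open>The slope that the linearization of \<open>r\<close> adds to the active function. With it the two cases of
  the second moment assumption become one.\<close>

definition shift :: "'a \<Rightarrow> 'a" where
  "shift u = (if sel u = 0 then n else 0)"

definition grad_sample :: "'a \<Rightarrow> 'z \<Rightarrow> 'a" where
  "grad_sample u z = g (sel u) u z"

definition step_map :: "nat \<Rightarrow> 'a \<Rightarrow> 'z \<Rightarrow> 'a" where
  "step_map k u z = (if sel u = 0 then prox (\<alpha> k) r (u - \<alpha> k *\<^sub>R grad_sample u z)
     else u - \<alpha> k *\<^sub>R grad_sample u z)"

text \<open>The iterates as functions of the sample sequence. Only the first \<open>k\<close> samples enter \<open>iterate k\<close>,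
  which is what makes the \<open>k\<close>-th iterate independent of the \<open>k\<close>-th sample.\<close>

primrec iterate :: "nat \<Rightarrow> (nat \<Rightarrow> 'z) \<Rightarrow> 'a" where
  "iterate 0 w = x0"
| "iterate (Suc k) w = step_map k (iterate k w) (w k)"

abbreviation "\<delta> \<equiv> delta f m r sel y n"

lemma feasible_iff: "feasible f m u \<longleftrightarrow> sel u = 0"
  using sel[unfolded selection_rule_def, rule_format, of u] by (auto split: if_splits)

lemma sel_le: "sel u \<le> m"
  using sel[unfolded selection_rule_def, rule_format, of u] by (auto split: if_splits)

lemma violated_pos: "sel u \<noteq> 0 \<Longrightarrow> f (sel u) u > 0"
  using sel[unfolded selection_rule_def, rule_format, of u] feasible_iff[of u] by (auto split: if_splits)

lemma delta_eq: "\<delta> u = active u u - active u y"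
  by (simp add: delta_def active_def feasible_iff)

text \<open>At a feasible point \<open>y\<close> minimizes the linearized objective; at an infeasible one the selected
  constraint is positive at \<open>u\<close> and nonpositive at \<open>y\<close>.\<close>

lemma delta_nonneg: "\<delta> u \<ge> 0"
proof (cases "sel u = 0")
  case True
  then show ?thesis
    using y_minimal by (auto simp: delta_def feasible_iff is_arg_min_linorder)
next
  case False
  then have "f (sel u) y \<le> 0"
    using feasible_y sel_le[of u] by (auto simp: feasible_def)
  with False violated_pos[of u] show ?thesis by (simp add: delta_def feasible_iff)
qed

lemma X_Suc: "\<omega> \<in> space P \<Longrightarrow> X \<omega> (Suc k) = step_map k (X \<omega> k) (\<xi> k \<omega>)"
  by (simp add: step step_map_def feasible_iff grad_sample_def)

lemma G_eq: "\<omega> \<in> space P \<Longrightarrow> G \<omega> k = grad_sample (X \<omega> k) (\<xi> k \<omega>)"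
  by (simp add: out grad_sample_def)

lemma path: "\<omega> \<in> space P \<Longrightarrow> weighted_path sel \<mu> \<alpha> lam (X \<omega>) (G \<omega>)"
  by unfold_locales (auto simp: mu_pos lam_pos alpha X_Suc step_map_def G_eq)

lemma alpha_pos: "\<alpha> k > 0"
proof -
  obtain \<omega> where "\<omega> \<in> space P" using not_empty by blast
  then interpret weighted_path f r sel \<mu> \<alpha> lam "X \<omega>" "G \<omega>" by (rule path)
  show ?thesis by (rule alpha_pos)
qed

lemma prox_subgrad_subdiff:
  assumes "\<omega> \<in> space P" "sel (X \<omega> k) = 0"
  shows "prox_subgrad \<alpha> (X \<omega>) (G \<omega>) k \<in> subdiff r (X \<omega> (Suc k))"
  using prox_subdiff[OF r n_subdiff alpha_pos, of k "X \<omega> k - \<alpha> k *\<^sub>R G \<omega> k"] assms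
  by (simp add: prox_subgrad_def X_Suc step_map_def G_eq)

text \<open>The point \<open>y\<close> is the proximal image of \<open>y + \<alpha>\<^sub>k n\<close>. Nonexpansiveness thus transforms the proximal step
  into a plain step along \<open>g\<^sub>k + n\<close>, whose second moment is controlled.\<close>

lemma step_dist_le:
  assumes \<omega>: "\<omega> \<in> space P"
  shows "norm (X \<omega> (Suc k) - y) \<le> norm (X \<omega> k - y - \<alpha> k *\<^sub>R (G \<omega> k + shift (X \<omega> k)))"
proof (cases "sel (X \<omega> k) = 0")
  case True
  define z where "z = X \<omega> k - \<alpha> k *\<^sub>R G \<omega> k"
  have "X \<omega> (Suc k) = prox (\<alpha> k) r z"
    using \<omega> True by (simp add: X_Suc step_map_def G_eq z_def)
  then have "(1 / \<alpha> k) *\<^sub>R (z - X \<omega> (Suc k)) \<in> subdiff r (X \<omega> (Suc k))"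
    using prox_subdiff[OF r n_subdiff alpha_pos] by simp
  moreover have "(1 / \<alpha> k) *\<^sub>R ((y + \<alpha> k *\<^sub>R n) - y) \<in> subdiff r y"
    using n_subdiff alpha_pos[of k] by simp
  ultimately have "norm (X \<omega> (Suc k) - y) \<le> norm (z - (y + \<alpha> k *\<^sub>R n))"
    by (rule resolvent_nonexpansive[OF r alpha_pos])
  then show ?thesis using True by (simp add: z_def shift_def algebra_simps)
next
  case False
  then show ?thesis using \<omega> by (simp add: X_Suc step_map_def G_eq shift_def algebra_simps)
qed

subsection \<open>Measurability and independence\<close>

lemma xi_rv [measurable]: "\<xi> k \<in> P \<rightarrow>\<^sub>M D"
  using indep by (auto simp: indep_vars_def)

lemma prob_space_D: "prob_space D"
  using prob_space_distr[OF xi_rv[of 0]] ident[of 0] by simp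

lemma sel_measurable [measurable]: "sel \<in> borel \<rightarrow>\<^sub>M count_space {..m}"
  using sel_borel sel_le by (auto simp: measurable_count_space_eq2_countable measurable_def)

lemma f_borel: "i \<le> m \<Longrightarrow> f i \<in> borel_measurable borel"
  using strongly_convex_continuous[OF strong] by (intro borel_measurable_continuous_onI)

lemma f_sel_borel [measurable]: "(\<lambda>u. f (sel u) u) \<in> borel_measurable borel"
  by (rule measurable_compose_countable'[OF _ sel_measurable]) (auto intro: f_borel)

lemma f_sel_y_borel [measurable]: "(\<lambda>u. f (sel u) y) \<in> borel_measurable borel"
  by (rule measurable_compose_countable'[OF _ sel_measurable]) auto

lemma sel_zero_sets [measurable]: "{u. sel u = 0} \<in> sets borel"
proof -
  have "sel -` {0} \<inter> space borel \<in> sets borel"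
    using sel_borel by (rule measurable_sets) simp
  then show ?thesis by (simp add: vimage_def)
qed

lemma sel_zero_pred [measurable]: "Measurable.pred borel (\<lambda>u. sel u = 0)"
  using sel_zero_sets by (simp add: pred_def)

lemma grad_sample_borel [measurable]: "(\<lambda>p. grad_sample (fst p) (snd p)) \<in> borel_measurable (borel \<Otimes>\<^sub>M D)"
  unfolding grad_sample_def
proof (rule measurable_compose_countable'[of "{..m}" "\<lambda>i p. g i (fst p) (snd p)" _ _ "\<lambda>p. sel (fst p)"])
  show "(\<lambda>p. g i (fst p) (snd p)) \<in> borel_measurable (borel \<Otimes>\<^sub>M D)" if "i \<in> {..m}" for i
    using g_borel[of i] that by (simp add: case_prod_beta')
qed auto

lemma r_borel [measurable]: "(\<lambda>u. real_of_ereal (r u)) \<in> borel_measurable borel"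
  using proper_closed_convex_measurable[OF r] by measurable

lemma prox_borel [measurable]: "prox (\<alpha> k) r \<in> borel_measurable borel"
  using continuous_on_prox[OF r n_subdiff alpha_pos] by (rule borel_measurable_continuous_onI)

lemma shift_borel [measurable]: "shift \<in> borel_measurable borel"
  unfolding shift_def[abs_def] by measurable

lemma active_borel [measurable]: "(\<lambda>u. active u u) \<in> borel_measurable borel"
proof -
  have [measurable]: "f 0 \<in> borel_measurable borel" by (rule f_borel) simp
  show ?thesis unfolding active_def lin_obj_def by measurable
qed

lemma active_y_borel [measurable]: "(\<lambda>u. active u y) \<in> borel_measurable borel"
  unfolding active_def by measurable

lemma delta_borel [measurable]: "\<delta> \<in> borel_measurable borel"
  unfolding delta_eq[abs_def] by measurable

lemma step_map_borel [measurable]: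
  "(\<lambda>p. step_map k (fst p) (snd p)) \<in> borel_measurable (borel \<Otimes>\<^sub>M D)"
  unfolding step_map_def by measurable

lemma iterate_borel: "{..<k} \<subseteq> J \<Longrightarrow> iterate k \<in> borel_measurable (Pi\<^sub>M J (\<lambda>_. D))"
proof (induction k)
  case 0
  have "iterate 0 = (\<lambda>_. x0)" by auto
  then show ?case by simp
next
  case (Suc k)
  have [measurable]: "iterate k \<in> borel_measurable (Pi\<^sub>M J (\<lambda>_. D))"
    using Suc.prems by (intro Suc.IH) auto
  have [measurable]: "(\<lambda>w. w k) \<in> Pi\<^sub>M J (\<lambda>_. D) \<rightarrow>\<^sub>M D"
    using Suc.prems by (intro measurable_component_singleton) auto
  have "(\<lambda>w. (iterate k w, w k)) \<in> Pi\<^sub>M J (\<lambda>_. D) \<rightarrow>\<^sub>M borel \<Otimes>\<^sub>M D" by measurable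
  from measurable_compose[OF this step_map_borel[of k]]
  have "(\<lambda>w. step_map k (iterate k w) (w k)) \<in> borel_measurable (Pi\<^sub>M J (\<lambda>_. D))" by simp
  moreover have "iterate (Suc k) = (\<lambda>w. step_map k (iterate k w) (w k))" by auto
  ultimately show ?case by simp
qed

lemma iterate_cong: "(\<And>i. i < k \<Longrightarrow> w i = w' i) \<Longrightarrow> iterate k w = iterate k w'"
  by (induction k) auto

lemma X_eq_iterate:
  assumes "\<omega> \<in> space P" shows "X \<omega> k = iterate k (restrict (\<lambda>i. \<xi> i \<omega>) {..<k})"
proof -
  have "X \<omega> k = iterate k (\<lambda>i. \<xi> i \<omega>)" using assms by (induction k) (auto simp: init X_Suc)
  also have "\<dots> = iterate k (restrict (\<lambda>i. \<xi> i \<omega>) {..<k})" by (rule iterate_cong) simp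
  finally show ?thesis .
qed

lemma past_rv [measurable]: "(\<lambda>\<omega>. restrict (\<lambda>i. \<xi> i \<omega>) A) \<in> P \<rightarrow>\<^sub>M Pi\<^sub>M A (\<lambda>_. D)"
  by (intro measurable_restrict) simp

lemma X_rv [measurable]: "(\<lambda>\<omega>. X \<omega> k) \<in> borel_measurable P"
  using measurable_compose[OF past_rv iterate_borel[of k "{..<k}"]]
  by (subst measurable_cong[OF X_eq_iterate]) auto

lemma G_rv [measurable]: "(\<lambda>\<omega>. G \<omega> k) \<in> borel_measurable P"
proof -
  have "(\<lambda>\<omega>. (X \<omega> k, \<xi> k \<omega>)) \<in> P \<rightarrow>\<^sub>M borel \<Otimes>\<^sub>M D" by measurable
  from measurable_compose[OF this grad_sample_borel] show ?thesis
    by (subst measurable_cong[OF G_eq]) auto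
qed

text \<open>Independence of the past \<open>\<xi>\<^sub>0, \<dots>, \<xi>\<^sub>k\<^sub>-\<^sub>1\<close> from \<open>\<xi>\<^sub>k\<close>. Both variables of an \<open>indep_var\<close> pair live in
  one type, so \<open>\<xi>\<^sub>k\<close> is first regarded as a family indexed by
  \<open>{k}\<close>, and the maps to the iterate and to the sample are applied to the product law afterwards.\<close>

lemma joint_law:
  "distr P (borel \<Otimes>\<^sub>M D) (\<lambda>\<omega>. (X \<omega> k, \<xi> k \<omega>)) = distr P borel (\<lambda>\<omega>. X \<omega> k) \<Otimes>\<^sub>M D"
proof -
  let ?R = "\<lambda>A \<omega>. restrict (\<lambda>i. \<xi> i \<omega>) A" and ?M = "\<lambda>A. Pi\<^sub>M A (\<lambda>_. D)"
  let ?A = "distr P (?M {..<k}) (?R {..<k})" and ?B = "distr P (?M {k}) (?R {k})"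
  have [measurable]: "iterate k \<in> borel_measurable (?M {..<k})" by (rule iterate_borel) simp
  have [measurable]: "(\<lambda>w. w k) \<in> ?M {k} \<rightarrow>\<^sub>M D" by (rule measurable_component_singleton) simp
  interpret D: prob_space D by (rule prob_space_D)
  have X: "distr ?A borel (iterate k) = distr P borel (\<lambda>\<omega>. X \<omega> k)"
    by (subst distr_distr) (auto intro!: distr_cong simp: X_eq_iterate)
  have xi: "distr ?B D (\<lambda>w. w k) = D"
    by (subst distr_distr) (auto simp: comp_def ident)
  have "distr P borel (\<lambda>\<omega>. X \<omega> k) \<Otimes>\<^sub>M D = distr ?A borel (iterate k) \<Otimes>\<^sub>M distr ?B D (\<lambda>w. w k)"
    by (simp only: X xi)
  also have "\<dots> = distr (?A \<Otimes>\<^sub>M ?B) (borel \<Otimes>\<^sub>M D) (\<lambda>(v, w). (iterate k v, w k))"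
    by (rule pair_measure_distr) (auto simp: xi D.sigma_finite_measure_axioms)
  also have "?A \<Otimes>\<^sub>M ?B = distr P (?M {..<k} \<Otimes>\<^sub>M ?M {k}) (\<lambda>\<omega>. (?R {..<k} \<omega>, ?R {k} \<omega>))"
    using indep_var_restrict[OF indep, of "{..<k}" "{k}"] by (simp add: indep_var_distribution_eq)
  also have "distr \<dots> (borel \<Otimes>\<^sub>M D) (\<lambda>(v, w). (iterate k v, w k))
      = distr P (borel \<Otimes>\<^sub>M D) (\<lambda>\<omega>. (X \<omega> k, \<xi> k \<omega>))"
    by (subst distr_distr) (auto intro!: distr_cong simp: X_eq_iterate)
  finally show ?thesis ..
qed

text \<open>Conditioning on the current iterate, in the form of Fubini's theorem for the joint law. The
  version for nonnegative functions yields finiteness of moments; the one for integrable functions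
  then computes means.\<close>

lemma nn_integral_next_sample:
  assumes [measurable]: "\<psi> \<in> borel_measurable (borel \<Otimes>\<^sub>M D)"
  shows "(\<integral>\<^sup>+\<omega>. \<psi> (X \<omega> k, \<xi> k \<omega>) \<partial>P) = (\<integral>\<^sup>+\<omega>. \<integral>\<^sup>+z. \<psi> (X \<omega> k, z) \<partial>D \<partial>P)"
proof -
  interpret D: prob_space D by (rule prob_space_D)
  have "(\<integral>\<^sup>+\<omega>. \<psi> (X \<omega> k, \<xi> k \<omega>) \<partial>P)
      = (\<integral>\<^sup>+p. \<psi> p \<partial>distr P (borel \<Otimes>\<^sub>M D) (\<lambda>\<omega>. (X \<omega> k, \<xi> k \<omega>)))"
    by (subst nn_integral_distr) auto
  also have "\<dots> = (\<integral>\<^sup>+u. \<integral>\<^sup>+z. \<psi> (u, z) \<partial>D \<partial>distr P borel (\<lambda>\<omega>. X \<omega> k))"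
    unfolding joint_law by (subst D.nn_integral_fst) auto
  also have "\<dots> = (\<integral>\<^sup>+\<omega>. \<integral>\<^sup>+z. \<psi> (X \<omega> k, z) \<partial>D \<partial>P)"
    by (subst nn_integral_distr) auto
  finally show ?thesis .
qed

lemma integral_next_sample:
  fixes \<psi> :: "'a \<times> 'z \<Rightarrow> real"
  assumes [measurable]: "\<psi> \<in> borel_measurable (borel \<Otimes>\<^sub>M D)"
    and int: "integrable P (\<lambda>\<omega>. \<psi> (X \<omega> k, \<xi> k \<omega>))"
  shows "integrable P (\<lambda>\<omega>. \<integral>z. \<psi> (X \<omega> k, z) \<partial>D)"
    and "(\<integral>\<omega>. \<psi> (X \<omega> k, \<xi> k \<omega>) \<partial>P) = (\<integral>\<omega>. \<integral>z. \<psi> (X \<omega> k, z) \<partial>D \<partial>P)"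
proof -
  let ?Q = "distr P borel (\<lambda>\<omega>. X \<omega> k)"
  interpret D: prob_space D by (rule prob_space_D)
  interpret Q: prob_space ?Q by (rule prob_space_distr) simp
  interpret QD: pair_prob_space ?Q D ..
  have i: "integrable (?Q \<Otimes>\<^sub>M D) \<psi>"
    unfolding joint_law[symmetric] using int by (subst integrable_distr_eq) auto
  have "integrable ?Q (\<lambda>u. \<integral>z. \<psi> (u, z) \<partial>D)" using QD.integrable_fst'[OF i] .
  then show "integrable P (\<lambda>\<omega>. \<integral>z. \<psi> (X \<omega> k, z) \<partial>D)"
    by (subst (asm) integrable_distr_eq) auto
  have "(\<integral>\<omega>. \<psi> (X \<omega> k, \<xi> k \<omega>) \<partial>P) = (\<integral>p. \<psi> p \<partial>(?Q \<Otimes>\<^sub>M D))"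
    unfolding joint_law[symmetric] by (subst integral_distr) auto
  also have "\<dots> = (\<integral>u. \<integral>z. \<psi> (u, z) \<partial>D \<partial>?Q)" using QD.integral_fst'[OF i] by simp
  also have "\<dots> = (\<integral>\<omega>. \<integral>z. \<psi> (X \<omega> k, z) \<partial>D \<partial>P)"
    by (subst integral_distr) auto
  finally show "(\<integral>\<omega>. \<psi> (X \<omega> k, \<xi> k \<omega>) \<partial>P) = (\<integral>\<omega>. \<integral>z. \<psi> (X \<omega> k, z) \<partial>D \<partial>P)" .
qed

subsection \<open>Square integrability of the iterates\<close>

lemma grad_sample_moment:
  "AE \<omega> in P. integrable D (\<lambda>z. (norm (grad_sample (X \<omega> k) z + shift (X \<omega> k)))\<^sup>2) \<and>
     (\<integral>z. (norm (grad_sample (X \<omega> k) z + shift (X \<omega> k)))\<^sup>2 \<partial>D) \<le> L0\<^sup>2 + L1 * \<delta> (X \<omega> k)"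
  using moment
proof eventually_elim
  case (elim \<omega>)
  then show ?case
    using elim[rule_format, of k] by (cases "sel (X \<omega> k) = 0") (auto simp: feasible_iff grad_sample_def shift_def)
qed

lemma grad_sample_integrable: "integrable D (grad_sample u)"
  unfolding grad_sample_def[abs_def] using g_integrable[OF sel_le] by simp

lemma mean_grad_sample_strong_lower:
  "f (sel u) u + (\<integral>z. grad_sample u z \<partial>D) \<bullet> (v - u) + \<mu> / 2 * (norm (v - u))\<^sup>2 \<le> f (sel u) v"
  unfolding grad_sample_def[abs_def] by (rule strongly_convex_subgradient[OF strong[OF sel_le] g_unbiased[OF sel_le]])

text \<open>Convexity of the active function, with the mean of the samples as subgradient.\<close>

lemma delta_le_slope: "\<delta> u \<le> ((\<integral>z. grad_sample u z \<partial>D) + shift u) \<bullet> (u - y)"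
proof -
  have "0 \<le> \<mu> / 2 * (norm (y - u))\<^sup>2" using mu_pos by simp
  then have "f (sel u) u - f (sel u) y \<le> (\<integral>z. grad_sample u z \<partial>D) \<bullet> (u - y)"
    using mean_grad_sample_strong_lower[of u y] by (simp add: inner_diff_right)
  then show ?thesis
    by (auto simp: delta_eq active_def lin_obj_def shift_def inner_add_left)
qed

text \<open>The second moment bounds \<open>\<delta>\<close> through \<open>delta_le_slope\<close>, and \<open>\<delta>\<close> bounds the second moment. Young's
  inequality with parameter \<open>c = L1 + 1\<close> puts the factor \<open>L1 / (2 c) < 1/2\<close> in front of \<open>\<delta>\<close> on the right, so
  that this term can be absorbed on the left.\<close>

lemma delta_le_quadratic:
  assumes int: "integrable D (\<lambda>z. (norm (grad_sample u z + shift u))\<^sup>2)"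
    and le: "(\<integral>z. (norm (grad_sample u z + shift u))\<^sup>2 \<partial>D) \<le> L0\<^sup>2 + L1 * \<delta> u"
  shows "\<delta> u \<le> L0\<^sup>2 + (L1 + 1) * (norm (u - y))\<^sup>2"
proof -
  interpret D: prob_space D by (rule prob_space_D)
  \<comment> \<open>Any \<open>c > L1 / 2\<close> would allow the absorption; this choice gives clean constants for all \<open>L1 \<ge> 0\<close>.\<close>
  define c where "c = L1 + 1"
  have c: "c \<ge> 1" using L1_nonneg by (simp add: c_def)
  have i: "integrable D (\<lambda>z. grad_sample u z + shift u)" using grad_sample_integrable by simp
  have "\<delta> u \<le> ((\<integral>z. grad_sample u z \<partial>D) + shift u) \<bullet> (u - y)" by (rule delta_le_slope)
  also have "(\<integral>z. grad_sample u z \<partial>D) + shift u = (\<integral>z. grad_sample u z + shift u \<partial>D)"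
    using grad_sample_integrable by (simp add: D.prob_space)
  also have "\<dots> \<bullet> (u - y) = (\<integral>z. (grad_sample u z + shift u) \<bullet> (u - y) \<partial>D)"
    using i by simp
  also have "\<dots> \<le> (\<integral>z. 1 / (2 * c) * (norm (grad_sample u z + shift u))\<^sup>2 + c / 2 * (norm (u - y))\<^sup>2 \<partial>D)"
  proof (rule integral_mono)
    fix z
    have "- (1 / (2 * c) * (norm (grad_sample u z + shift u))\<^sup>2)
      \<le> (grad_sample u z + shift u) \<bullet> (y - u) + 1 / (4 * (1 / (2 * c))) * (norm (y - u))\<^sup>2"
      using c by (intro inner_plus_quadratic_ge) simp
    then show "(grad_sample u z + shift u) \<bullet> (u - y)
      \<le> 1 / (2 * c) * (norm (grad_sample u z + shift u))\<^sup>2 + c / 2 * (norm (u - y))\<^sup>2"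
      using c by (simp add: inner_diff_right norm_minus_commute)
  qed (use i int in auto)
  also have "\<dots> = 1 / (2 * c) * (\<integral>z. (norm (grad_sample u z + shift u))\<^sup>2 \<partial>D) + c / 2 * (norm (u - y))\<^sup>2"
    using int by (simp add: D.prob_space)
  also have "\<dots> \<le> 1 / (2 * c) * (L0\<^sup>2 + L1 * \<delta> u) + c / 2 * (norm (u - y))\<^sup>2"
    using le c by (intro add_right_mono mult_left_mono) auto
  finally have "c * \<delta> u \<le> c * (1 / (2 * c) * (L0\<^sup>2 + L1 * \<delta> u) + c / 2 * (norm (u - y))\<^sup>2)"
    using c by (intro mult_left_mono) auto
  also have "\<dots> = (L0\<^sup>2 + L1 * \<delta> u + c * (c * (norm (u - y))\<^sup>2)) / 2"
    using c by (simp add: field_simps)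
  finally have "c * \<delta> u + \<delta> u \<le> L0\<^sup>2 + c * (c * (norm (u - y))\<^sup>2)"
    by (simp add: c_def algebra_simps)
  then have "c * \<delta> u \<le> c * (L0\<^sup>2 + c * (norm (u - y))\<^sup>2)"
    using delta_nonneg[of u] mult_right_mono[OF c, of "L0\<^sup>2"] by (simp add: distrib_left)
  then show ?thesis using c by (simp add: c_def)
qed

abbreviation "square_integrable_iterate k \<equiv> integrable P (\<lambda>\<omega>. (norm (X \<omega> k - y))\<^sup>2)"

lemma delta_integrable:
  assumes "square_integrable_iterate k"
  shows "integrable P (\<lambda>\<omega>. \<delta> (X \<omega> k))"
proof (rule Bochner_Integration.integrable_bound)
  show "integrable P (\<lambda>\<omega>. L0\<^sup>2 + (L1 + 1) * (norm (X \<omega> k - y))\<^sup>2)" using assms by simp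
  show "AE \<omega> in P. norm (\<delta> (X \<omega> k)) \<le> norm (L0\<^sup>2 + (L1 + 1) * (norm (X \<omega> k - y))\<^sup>2)"
    using grad_sample_moment[of k]
  proof eventually_elim
    case (elim \<omega>)
    then show ?case using delta_le_quadratic[of "X \<omega> k"] delta_nonneg[of "X \<omega> k"] by simp
  qed
qed measurable

text \<open>Integrating the conditional second moment bound over the iterate. Finiteness is obtained on the
  way, as it is not known beforehand that \<open>g\<^sub>k\<close> is square integrable over the joint law.\<close>

lemma shifted_grad_moment:
  assumes sq: "square_integrable_iterate k"
  shows "integrable P (\<lambda>\<omega>. (norm (G \<omega> k + shift (X \<omega> k)))\<^sup>2)" (is ?I)
    and "(\<integral>\<omega>. (norm (G \<omega> k + shift (X \<omega> k)))\<^sup>2 \<partial>P) \<le> L0\<^sup>2 + L1 * (\<integral>\<omega>. \<delta> (X \<omega> k) \<partial>P)" (is ?B)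
proof -
  let ?\<psi> = "\<lambda>p. ennreal ((norm (grad_sample (fst p) (snd p) + shift (fst p)))\<^sup>2)"
  have b: "0 \<le> L0\<^sup>2 + L1 * \<delta> u" for u using L1_nonneg delta_nonneg[of u] by simp
  have i: "integrable P (\<lambda>\<omega>. L0\<^sup>2 + L1 * \<delta> (X \<omega> k))" using delta_integrable[OF sq] by simp
  have "(\<integral>\<^sup>+\<omega>. ennreal ((norm (G \<omega> k + shift (X \<omega> k)))\<^sup>2) \<partial>P) = (\<integral>\<^sup>+\<omega>. ?\<psi> (X \<omega> k, \<xi> k \<omega>) \<partial>P)"
    by (rule nn_integral_cong) (simp add: G_eq)
  also have "\<dots> = (\<integral>\<^sup>+\<omega>. \<integral>\<^sup>+z. ?\<psi> (X \<omega> k, z) \<partial>D \<partial>P)" by (rule nn_integral_next_sample) measurable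
  also have "\<dots> \<le> (\<integral>\<^sup>+\<omega>. ennreal (L0\<^sup>2 + L1 * \<delta> (X \<omega> k)) \<partial>P)"
  proof (rule nn_integral_mono_AE)
    show "AE \<omega> in P. (\<integral>\<^sup>+z. ?\<psi> (X \<omega> k, z) \<partial>D) \<le> ennreal (L0\<^sup>2 + L1 * \<delta> (X \<omega> k))"
      using grad_sample_moment[of k]
    proof eventually_elim
      case (elim \<omega>)
      then show ?case
        by (subst nn_integral_eq_integral) (auto intro!: ennreal_leI)
    qed
  qed
  also have "\<dots> = ennreal (\<integral>\<omega>. L0\<^sup>2 + L1 * \<delta> (X \<omega> k) \<partial>P)"
    using i b by (intro nn_integral_eq_integral) auto
  finally have *: "(\<integral>\<^sup>+\<omega>. ennreal ((norm (G \<omega> k + shift (X \<omega> k)))\<^sup>2) \<partial>P)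
      \<le> ennreal (\<integral>\<omega>. L0\<^sup>2 + L1 * \<delta> (X \<omega> k) \<partial>P)" .
  show I: ?I
    by (rule integrableI_bounded) (use * in \<open>auto simp: le_less_trans[OF _ ennreal_less_top]\<close>)
  have "0 \<le> (\<integral>\<omega>. L0\<^sup>2 + L1 * \<delta> (X \<omega> k) \<partial>P)" using b by simp
  with * have "(\<integral>\<omega>. (norm (G \<omega> k + shift (X \<omega> k)))\<^sup>2 \<partial>P) \<le> (\<integral>\<omega>. L0\<^sup>2 + L1 * \<delta> (X \<omega> k) \<partial>P)"
    using I by (subst (asm) nn_integral_eq_integral) auto
  then show ?B using delta_integrable[OF sq] by (simp add: prob_space)
qed

text \<open>The induction alternates between the iterate and the sample: a square integrable iterate makes
  \<open>\<delta>\<^sub>k\<close> integrable, which makes \<open>g\<^sub>k + b\<^sub>k\<close> square integrable, which makes the next iterate square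
  integrable.\<close>

lemma square_integrable: "square_integrable_iterate k"
proof (induction k)
  case 0
  have "integrable P (\<lambda>\<omega>. (norm (x0 - y))\<^sup>2)" by simp
  then show ?case by (subst Bochner_Integration.integrable_cong[OF refl]) (auto simp: init)
next
  case (Suc k)
  show ?case
  proof (rule Bochner_Integration.integrable_bound)
    show "integrable P (\<lambda>\<omega>. 2 * (norm (X \<omega> k - y))\<^sup>2 + 2 * ((\<alpha> k)\<^sup>2 * (norm (G \<omega> k + shift (X \<omega> k)))\<^sup>2))"
      using Suc shifted_grad_moment(1)[OF Suc] by simp
    show "AE \<omega> in P. norm ((norm (X \<omega> (Suc k) - y))\<^sup>2)
        \<le> norm (2 * (norm (X \<omega> k - y))\<^sup>2 + 2 * ((\<alpha> k)\<^sup>2 * (norm (G \<omega> k + shift (X \<omega> k)))\<^sup>2))"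
    proof (rule AE_I2)
      fix \<omega> assume \<omega>: "\<omega> \<in> space P"
      have "(norm (X \<omega> (Suc k) - y))\<^sup>2 \<le> (norm (X \<omega> k - y - \<alpha> k *\<^sub>R (G \<omega> k + shift (X \<omega> k))))\<^sup>2"
        by (intro power_mono step_dist_le[OF \<omega>]) simp
      also have "\<dots> \<le> 2 * (norm (X \<omega> k - y))\<^sup>2 + 2 * (norm (\<alpha> k *\<^sub>R (G \<omega> k + shift (X \<omega> k))))\<^sup>2"
        using norm_add_sq_le[of "X \<omega> k - y" "- (\<alpha> k *\<^sub>R (G \<omega> k + shift (X \<omega> k)))"] by (simp only: norm_minus_cancel diff_conv_add_uminus)
      finally show "norm ((norm (X \<omega> (Suc k) - y))\<^sup>2)
        \<le> norm (2 * (norm (X \<omega> k - y))\<^sup>2 + 2 * ((\<alpha> k)\<^sup>2 * (norm (G \<omega> k + shift (X \<omega> k)))\<^sup>2))"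
        by (simp add: power_mult_distrib)
    qed
  qed measurable
qed

section \<open>The expected gap\<close>

(* Pushing the absolute value into the extended reals would hide it from linear arithmetic. *)
declare abs_real_of_ereal [simp del]

abbreviation "Lam T \<equiv> (\<Sum>k<T. lam k)"

lemma Lam_pos: "T \<ge> 1 \<Longrightarrow> Lam T > 0"
  using lam_pos by (intro sum_pos) (auto simp: lessThan_empty_iff)

lemma active_y_bounded: "\<bar>active u y\<bar> \<le> (\<Sum>i\<le>m. \<bar>f i y\<bar>) + \<bar>real_of_ereal (r y)\<bar>"
proof -
  have "\<bar>f (sel u) y\<bar> \<le> (\<Sum>i\<le>m. \<bar>f i y\<bar>)"
    using sel_le[of u] by (intro member_le_sum) auto
  then show ?thesis by (auto simp: active_def lin_obj_def)
qed

lemma active_y_integrable: "integrable P (\<lambda>\<omega>. active (X \<omega> k) y)"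
  by (rule integrable_const_bound[of _ "(\<Sum>i\<le>m. \<bar>f i y\<bar>) + \<bar>real_of_ereal (r y)\<bar>"])
     (auto simp: active_y_bounded)

lemma f_sel_y_integrable: "integrable P (\<lambda>\<omega>. f (sel (X \<omega> k)) y)"
  by (rule integrable_const_bound[of _ "\<Sum>i\<le>m. \<bar>f i y\<bar>"])
     (auto intro!: AE_I2 member_le_sum[of _ _ "\<lambda>i. \<bar>f i y\<bar>"] sel_le)

lemma active_integrable: "integrable P (\<lambda>\<omega>. active (X \<omega> k) (X \<omega> k))"
proof -
  have "integrable P (\<lambda>\<omega>. \<delta> (X \<omega> k) + active (X \<omega> k) y)"
    using delta_integrable[OF square_integrable] active_y_integrable by simp
  then show ?thesis by (simp add: delta_eq)
qed

lemma G_square_integrable: "integrable P (\<lambda>\<omega>. (norm (G \<omega> k))\<^sup>2)"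
proof (rule Bochner_Integration.integrable_bound)
  show "integrable P (\<lambda>\<omega>. 2 * (norm (G \<omega> k + shift (X \<omega> k)))\<^sup>2 + 2 * (norm n)\<^sup>2)"
    using shifted_grad_moment(1)[OF square_integrable] by simp
  have "(norm (G \<omega> k))\<^sup>2 \<le> 2 * (norm (G \<omega> k + shift (X \<omega> k)))\<^sup>2 + 2 * (norm n)\<^sup>2" for \<omega>
    using norm_add_sq_le[of "G \<omega> k + shift (X \<omega> k)" "- shift (X \<omega> k)"]
      power_mono[of "norm (shift (X \<omega> k))" "norm n" 2] by (auto simp: shift_def split: if_splits)
  then show "AE \<omega> in P. norm ((norm (G \<omega> k))\<^sup>2) \<le> norm (2 * (norm (G \<omega> k + shift (X \<omega> k)))\<^sup>2 + 2 * (norm n)\<^sup>2)"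
    by simp
qed measurable

lemma square_integrable_rev: "integrable P (\<lambda>\<omega>. (norm (y - X \<omega> k))\<^sup>2)"
  using square_integrable[of k] by (simp add: norm_minus_commute)

lemma f_sel_integrable: "integrable P (\<lambda>\<omega>. f (sel (X \<omega> k)) (X \<omega> k))"
proof (rule Bochner_Integration.integrable_bound)
  let ?b = "\<lambda>\<omega>. norm (active (X \<omega> k) (X \<omega> k)) + (\<bar>real_of_ereal (r y)\<bar> + ((norm n)\<^sup>2 + (norm (X \<omega> k - y))\<^sup>2))"
  show "integrable P ?b"
    using active_integrable square_integrable by simp
  have "norm (f (sel (X \<omega> k)) (X \<omega> k)) \<le> norm (?b \<omega>)" for \<omega>
    using abs_inner_le_sq[of n "X \<omega> k - y"] by (auto simp: active_def lin_obj_def)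
  then show "AE \<omega> in P. norm (f (sel (X \<omega> k)) (X \<omega> k)) \<le> norm (?b \<omega>)" by simp
qed measurable

text \<open>The summand of step \<open>k\<close> at \<open>y\<close> is split into the cut of the active \<open>f\<close>, bounded only on average,
  and the cut of \<open>r\<close>, bounded on every path.\<close>

definition f_cut :: "'w \<Rightarrow> nat \<Rightarrow> real" where
  "f_cut \<omega> k = f (sel (X \<omega> k)) (X \<omega> k) + G \<omega> k \<bullet> (y - X \<omega> k) + \<mu> / 2 * (norm (y - X \<omega> k))\<^sup>2"

definition r_cut :: "'w \<Rightarrow> nat \<Rightarrow> real" where
  "r_cut \<omega> k = (if sel (X \<omega> k) = 0
     then real_of_ereal (r (X \<omega> (Suc k))) + prox_subgrad \<alpha> (X \<omega>) (G \<omega>) k \<bullet> (y - X \<omega> (Suc k)) else 0)"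

text \<open>The cut is linear in the sample, so integrating over \<open>\<xi>\<^sub>k\<close> with the iterate fixed replaces the sample
  by its mean, a true subgradient of a strongly convex function.\<close>

lemma f_cut_expectation:
  shows "integrable P (\<lambda>\<omega>. f_cut \<omega> k)"
    and "(\<integral>\<omega>. f_cut \<omega> k \<partial>P) \<le> (\<integral>\<omega>. f (sel (X \<omega> k)) y \<partial>P)"
proof -
  let ?\<psi> = "\<lambda>p. grad_sample (fst p) (snd p) \<bullet> (y - fst p)"
  have cross: "integrable P (\<lambda>\<omega>. G \<omega> k \<bullet> (y - X \<omega> k))"
    by (rule integrable_inner) (auto simp: G_square_integrable square_integrable_rev)
  show I: "integrable P (\<lambda>\<omega>. f_cut \<omega> k)"
    unfolding f_cut_def using cross f_sel_integrable square_integrable_rev by simp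
  have \<psi>: "integrable P (\<lambda>\<omega>. ?\<psi> (X \<omega> k, \<xi> k \<omega>))"
    using cross by (subst Bochner_Integration.integrable_cong[OF refl]) (auto simp: G_eq)
  have mean: "(\<integral>z. ?\<psi> (u, z) \<partial>D) = (\<integral>z. grad_sample u z \<partial>D) \<bullet> (y - u)" for u
    using grad_sample_integrable by simp
  have cross': "integrable P (\<lambda>\<omega>. (\<integral>z. grad_sample (X \<omega> k) z \<partial>D) \<bullet> (y - X \<omega> k))"
    using integral_next_sample(1)[OF _ \<psi>] unfolding mean by simp
  have "(\<integral>\<omega>. G \<omega> k \<bullet> (y - X \<omega> k) \<partial>P) = (\<integral>\<omega>. ?\<psi> (X \<omega> k, \<xi> k \<omega>) \<partial>P)"
    by (rule Bochner_Integration.integral_cong) (auto simp: G_eq)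
  also have "\<dots> = (\<integral>\<omega>. (\<integral>z. grad_sample (X \<omega> k) z \<partial>D) \<bullet> (y - X \<omega> k) \<partial>P)"
    using integral_next_sample(2)[OF _ \<psi>] unfolding mean by simp
  finally have "(\<integral>\<omega>. f_cut \<omega> k \<partial>P) = (\<integral>\<omega>. f (sel (X \<omega> k)) (X \<omega> k)
      + (\<integral>z. grad_sample (X \<omega> k) z \<partial>D) \<bullet> (y - X \<omega> k) + \<mu> / 2 * (norm (y - X \<omega> k))\<^sup>2 \<partial>P)"
    unfolding f_cut_def using cross cross' f_sel_integrable square_integrable_rev by simp
  also have "\<dots> \<le> (\<integral>\<omega>. f (sel (X \<omega> k)) y \<partial>P)"
  proof (rule integral_mono)
    show "integrable P (\<lambda>\<omega>. f (sel (X \<omega> k)) (X \<omega> k)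
      + (\<integral>z. grad_sample (X \<omega> k) z \<partial>D) \<bullet> (y - X \<omega> k) + \<mu> / 2 * (norm (y - X \<omega> k))\<^sup>2)"
      using cross' f_sel_integrable square_integrable_rev by simp
    show "integrable P (\<lambda>\<omega>. f (sel (X \<omega> k)) y)" by (rule f_sel_y_integrable)
  qed (rule mean_grad_sample_strong_lower)
  finally show "(\<integral>\<omega>. f_cut \<omega> k \<partial>P) \<le> (\<integral>\<omega>. f (sel (X \<omega> k)) y \<partial>P)" .
qed

lemma r_cut_le:
  assumes "\<omega> \<in> space P"
  shows "r_cut \<omega> k \<le> (if sel (X \<omega> k) = 0 then real_of_ereal (r y) else 0)"
  using subdiff_real_le[OF r prox_subgrad_subdiff[OF assms] n_subdiff, of k] by (auto simp: r_cut_def)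

text \<open>The value \<open>r x\<^sub>k\<^sub>+\<^sub>1\<close> has no evident integrable upper bound. It is caught between the minorant of \<open>r\<close> at
  \<open>y\<close> and the cut of \<open>r\<close> at \<open>x\<^sub>k\<^sub>+\<^sub>1\<close>, whose slope is square integrable because it is a combination of iterates
  and samples.\<close>

lemma r_cut_integrable: "integrable P (\<lambda>\<omega>. r_cut \<omega> k)"
proof -
  let ?N = "\<lambda>\<omega>. prox_subgrad \<alpha> (X \<omega>) (G \<omega>) k"
  have N_borel [measurable]: "?N \<in> borel_measurable P" unfolding prox_subgrad_def by measurable
  have N_sq: "integrable P (\<lambda>\<omega>. (norm (?N \<omega>))\<^sup>2)"
  proof (rule Bochner_Integration.integrable_bound)
    let ?b = "\<lambda>\<omega>. 2 * (2 * ((1 / \<alpha> k)\<^sup>2 * (norm (X \<omega> k - y))\<^sup>2) + 2 * ((1 / \<alpha> k)\<^sup>2 * (norm (y - X \<omega> (Suc k)))\<^sup>2))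
      + 2 * (norm (G \<omega> k))\<^sup>2"
    show "integrable P ?b"
      using square_integrable square_integrable_rev G_square_integrable by simp
    have "(norm (?N \<omega>))\<^sup>2 \<le> ?b \<omega>" for \<omega>
    proof -
      let ?a = "(1 / \<alpha> k) *\<^sub>R (X \<omega> k - y)" and ?c = "(1 / \<alpha> k) *\<^sub>R (y - X \<omega> (Suc k))"
      have "?N \<omega> = (?a + ?c) + - G \<omega> k"
        using alpha_pos[of k] by (simp add: prox_subgrad_def scaleR_diff_right)
      then have "(norm (?N \<omega>))\<^sup>2 \<le> 2 * (norm (?a + ?c))\<^sup>2 + 2 * (norm (G \<omega> k))\<^sup>2"
        using norm_add_sq_le[of "?a + ?c" "- G \<omega> k"] by (simp only: norm_minus_cancel)
      also have "\<dots> \<le> 2 * (2 * (norm ?a)\<^sup>2 + 2 * (norm ?c)\<^sup>2) + 2 * (norm (G \<omega> k))\<^sup>2"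
        using norm_add_sq_le[of ?a ?c] by simp
      finally show ?thesis by (simp only: norm_scaleR power_mult_distrib power2_abs)
    qed
    then show "AE \<omega> in P. norm ((norm (?N \<omega>))\<^sup>2) \<le> norm (?b \<omega>)"
      by (intro AE_I2) (simp only: real_norm_def abs_of_nonneg[OF zero_le_power2] abs_ge_self order_trans[OF _ abs_ge_self])
  qed measurable
  let ?C = "\<bar>real_of_ereal (r y)\<bar>"
  have cross: "integrable P (\<lambda>\<omega>. ?N \<omega> \<bullet> (y - X \<omega> (Suc k)))"
    by (rule integrable_inner) (auto simp: N_sq square_integrable_rev)
  show ?thesis
  proof (rule Bochner_Integration.integrable_bound)
    show "integrable P (\<lambda>\<omega>. ?C + ((norm n)\<^sup>2 + (norm (X \<omega> (Suc k) - y))\<^sup>2) + \<bar>?N \<omega> \<bullet> (y - X \<omega> (Suc k))\<bar>)"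
      using cross square_integrable[of "Suc k"] by (auto intro!: Bochner_Integration.integrable_add)
    show "AE \<omega> in P. norm (r_cut \<omega> k)
      \<le> norm (?C + ((norm n)\<^sup>2 + (norm (X \<omega> (Suc k) - y))\<^sup>2) + \<bar>?N \<omega> \<bullet> (y - X \<omega> (Suc k))\<bar>)"
    proof (rule AE_I2)
      fix \<omega> assume \<omega>: "\<omega> \<in> space P"
      show "norm (r_cut \<omega> k)
        \<le> norm (?C + ((norm n)\<^sup>2 + (norm (X \<omega> (Suc k) - y))\<^sup>2) + \<bar>?N \<omega> \<bullet> (y - X \<omega> (Suc k))\<bar>)"
      proof (cases "sel (X \<omega> k) = 0")
        case True
        have "real_of_ereal (r y) + n \<bullet> (X \<omega> (Suc k) - y) \<le> real_of_ereal (r (X \<omega> (Suc k)))"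
          by (rule subdiff_real_le[OF r n_subdiff prox_subgrad_subdiff[OF \<omega> True]])
        moreover have "r_cut \<omega> k \<le> real_of_ereal (r y)"
          using r_cut_le[OF \<omega>, of k] True by simp
        ultimately show ?thesis
          using True abs_inner_le_sq[of n "X \<omega> (Suc k) - y"] zero_le_power2[of "norm n"]
            zero_le_power2[of "norm (X \<omega> (Suc k) - y)"]
          unfolding r_cut_def real_norm_def by simp
      qed (simp add: r_cut_def)
    qed
  qed (unfold r_cut_def, measurable)
qed

lemma model_piece_expectation:
  shows "integrable P (\<lambda>\<omega>. model_piece f r sel \<mu> \<alpha> (X \<omega>) (G \<omega>) k y)"
    and "(\<integral>\<omega>. model_piece f r sel \<mu> \<alpha> (X \<omega>) (G \<omega>) k y \<partial>P) \<le> (\<integral>\<omega>. active (X \<omega> k) y \<partial>P)"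
proof -
  have eq: "model_piece f r sel \<mu> \<alpha> (X \<omega>) (G \<omega>) k y = f_cut \<omega> k + r_cut \<omega> k" for \<omega>
    by (simp add: model_piece_def f_cut_def r_cut_def)
  show "integrable P (\<lambda>\<omega>. model_piece f r sel \<mu> \<alpha> (X \<omega>) (G \<omega>) k y)"
    unfolding eq using f_cut_expectation(1) r_cut_integrable by simp
  let ?ry = "\<lambda>\<omega>. if sel (X \<omega> k) = 0 then real_of_ereal (r y) else 0"
  have ry: "integrable P ?ry"
    by (rule integrable_const_bound[of _ "\<bar>real_of_ereal (r y)\<bar>"]) auto
  have "(\<integral>\<omega>. r_cut \<omega> k \<partial>P) \<le> (\<integral>\<omega>. ?ry \<omega> \<partial>P)"
    by (rule integral_mono[OF r_cut_integrable ry]) (rule r_cut_le)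
  moreover have "(\<integral>\<omega>. active (X \<omega> k) y \<partial>P) = (\<integral>\<omega>. f (sel (X \<omega> k)) y + ?ry \<omega> \<partial>P)"
    by (rule Bochner_Integration.integral_cong) (auto simp: active_def lin_obj_def)
  ultimately show "(\<integral>\<omega>. model_piece f r sel \<mu> \<alpha> (X \<omega>) (G \<omega>) k y \<partial>P) \<le> (\<integral>\<omega>. active (X \<omega> k) y \<partial>P)"
    unfolding eq using f_cut_expectation(1) f_cut_expectation(2)[of k] r_cut_integrable ry f_sel_y_integrable
    by simp
qed

abbreviation "model \<omega> \<equiv> aggregate_model f r sel \<mu> \<alpha> lam (X \<omega>) (G \<omega>)"

definition gap where
  "gap T \<omega> = feasible_weight sel lam (X \<omega>) T / Lam T *
        (primal_gap f m r sel y n lam (X \<omega>) T + dual_gap f m r sel \<mu> \<alpha> lam (X \<omega>) (G \<omega>) T)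
      + \<mu> / 2 * (norm (X \<omega> T - y))\<^sup>2"

definition feasible_value where
  "feasible_value T \<omega> = (\<Sum>k<T. if sel (X \<omega> k) = 0 then lam k * active (X \<omega> k) (X \<omega> k) else 0)"

lemma model_quadratic:
  "\<omega> \<in> space P \<Longrightarrow> model \<omega> T x = model \<omega> T (X \<omega> T) + \<mu> / 2 * Lam T * (norm (x - X \<omega> T))\<^sup>2"
  by (rule weighted_path.model_quadratic[OF path])

text \<open>The optimal value cancels, and the infimum of the model is its value at \<open>x\<^sub>T\<close>. Where no feasible
  iterate has occurred the weight in front of the gaps vanishes; including that null event makes the
  identity hold on the whole space, so that it transfers measurability and not only integrals.\<close>

lemma gap_eq:
  assumes \<omega>: "\<omega> \<in> space P" and T: "T \<ge> 1"
  shows "gap T \<omega> = (if feasible_weight sel lam (X \<omega>) T = 0 then 0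
      else (feasible_value T \<omega> - model \<omega> T y) / Lam T + \<mu> / 2 * (norm (X \<omega> T - y))\<^sup>2)
    + \<mu> / 2 * (norm (X \<omega> T - y))\<^sup>2"
proof (cases "feasible_weight sel lam (X \<omega>) T = 0")
  case False
  let ?W = "feasible_weight sel lam (X \<omega>) T"
  have Lam: "Lam T > 0" using T by (rule Lam_pos)
  have "?W \<ge> 0" unfolding feasible_weight_def using lam_pos by (intro sum_nonneg) (auto intro: less_imp_le)
  with False have W: "?W > 0" by simp
  have "(INF x. model \<omega> T x / ?W) = model \<omega> T (X \<omega> T) / ?W"
  proof (rule cInf_eq_minimum)
    show "model \<omega> T (X \<omega> T) / ?W \<in> range (\<lambda>x. model \<omega> T x / ?W)" by (rule rangeI)
  next
    fix z assume "z \<in> range (\<lambda>x. model \<omega> T x / ?W)"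
    then obtain x where z: "z = model \<omega> T x / ?W" by auto
    have "model \<omega> T (X \<omega> T) \<le> model \<omega> T x"
      using mu_pos Lam by (subst (2) model_quadratic[OF \<omega>]) simp
    then show "model \<omega> T (X \<omega> T) / ?W \<le> z" using W z by (simp add: divide_right_mono)
  qed
  moreover have "(\<Sum>k | k < T \<and> sel (X \<omega> k) = 0. lam k * lin_obj f r y n (X \<omega> k)) = feasible_value T \<omega>"
    unfolding sum_if_less feasible_value_def by (intro sum.cong) (auto simp: active_def)
  ultimately have "primal_gap f m r sel y n lam (X \<omega>) T + dual_gap f m r sel \<mu> \<alpha> lam (X \<omega>) (G \<omega>) T
      = (feasible_value T \<omega> - model \<omega> T (X \<omega> T)) / ?W"
    by (simp add: primal_gap_def dual_gap_def diff_divide_distrib)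
  moreover have "model \<omega> T (X \<omega> T) = model \<omega> T y - Lam T * (\<mu> / 2 * (norm (X \<omega> T - y))\<^sup>2)"
    using model_quadratic[OF \<omega>, of T y] by (simp add: norm_minus_commute)
  ultimately show ?thesis
    using False Lam by (simp add: gap_def field_simps)
qed (simp add: gap_def)

lemma model_lower:
  assumes \<omega>: "\<omega> \<in> space P"
  shows "(\<Sum>k<T. lam k * (active (X \<omega> k) (X \<omega> k) - \<alpha> k / 2 * (norm (G \<omega> k + shift (X \<omega> k)))\<^sup>2))
    \<le> model \<omega> T (X \<omega> T)"
  using weighted_path.model_min_ge[OF path[OF \<omega>] r n_subdiff prox_subgrad_subdiff[OF \<omega>], of f T]
  unfolding active_def shift_def by simp

text \<open>Infeasible iterates contribute positive terms, because a violated constraint is positive there.\<close>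

lemma feasible_value_le:
  "feasible_value T \<omega> \<le> (\<Sum>k<T. lam k * active (X \<omega> k) (X \<omega> k))"
  unfolding feasible_value_def
proof (rule sum_mono)
  fix k
  show "(if sel (X \<omega> k) = 0 then lam k * active (X \<omega> k) (X \<omega> k) else 0) \<le> lam k * active (X \<omega> k) (X \<omega> k)"
    using violated_pos[of "X \<omega> k"] lam_pos[of k] by (simp add: active_def mult_nonneg_nonneg less_imp_le)
qed

lemma expected_gap_bound:
  assumes T: "T \<ge> 1" and W: "AE \<omega> in P. feasible_weight sel lam (X \<omega>) T > 0"
  shows "integrable P (gap T)"
    and "(\<integral>\<omega>. gap T \<omega> \<partial>P) * Lam T \<le> L0\<^sup>2 * (\<Sum>k<T. lam k * \<alpha> k)
      + (\<Sum>k<T. lam k * ((L1 * \<alpha> k - 1) * (\<integral>\<omega>. \<delta> (X \<omega> k) \<partial>P)))"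
proof -
  have Lam: "Lam T > 0" using T by (rule Lam_pos)
  let ?Q = "\<lambda>\<omega>. (feasible_value T \<omega> - model \<omega> T y) / Lam T + \<mu> * (norm (X \<omega> T - y))\<^sup>2"
  have model_int: "integrable P (\<lambda>\<omega>. model \<omega> T y)"
    unfolding aggregate_model_eq_sum using model_piece_expectation(1) by simp
  have value_int: "integrable P (feasible_value T)"
    unfolding feasible_value_def[abs_def]
  proof (rule Bochner_Integration.integrable_sum)
    fix k
    show "integrable P (\<lambda>\<omega>. if sel (X \<omega> k) = 0 then lam k * active (X \<omega> k) (X \<omega> k) else 0)"
      by (rule Bochner_Integration.integrable_bound[of _ "\<lambda>\<omega>. lam k * active (X \<omega> k) (X \<omega> k)"])
         (auto simp: active_integrable)
  qed
  have Q_int: "integrable P ?Q"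
    using model_int value_int square_integrable[of T] by simp
  have AE_eq: "AE \<omega> in P. gap T \<omega> = ?Q \<omega>"
    using W by (rule AE_mp) (auto intro!: AE_I2 simp: gap_eq[OF _ T])
  have W_borel [measurable]: "(\<lambda>\<omega>. feasible_weight sel lam (X \<omega>) T) \<in> borel_measurable P"
    unfolding feasible_weight_def sum_if_less by measurable
  have [measurable]: "feasible_value T \<in> borel_measurable P" "(\<lambda>\<omega>. model \<omega> T y) \<in> borel_measurable P"
    using value_int model_int by auto
  have gap_borel: "gap T \<in> borel_measurable P"
    by (subst measurable_cong[OF gap_eq[OF _ T]]) measurable
  show gap_int: "integrable P (gap T)"
    using integrable_cong_AE[THEN iffD2, OF gap_borel borel_measurable_integrable[OF Q_int] AE_eq Q_int] .
  let ?B = "\<lambda>\<omega>. \<Sum>k<T. lam k * (model_piece f r sel \<mu> \<alpha> (X \<omega>) (G \<omega>) k y - active (X \<omega> k) (X \<omega> k)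
     + \<alpha> k * (norm (G \<omega> k + shift (X \<omega> k)))\<^sup>2)"
  have B_int: "integrable P ?B"
    using model_piece_expectation(1) active_integrable shifted_grad_moment(1)[OF square_integrable] by simp
  \<comment> \<open>The distance term is twice \<open>\<mu>/2\<close>, hence two gaps \<open>M y - M x\<^sub>T\<close>; one \<open>M y\<close> survives.\<close>
  have pathwise: "gap T \<omega> * Lam T \<le> ?B \<omega>" if \<omega>: "\<omega> \<in> space P" and eq: "gap T \<omega> = ?Q \<omega>" for \<omega>
  proof -
    have "gap T \<omega> * Lam T = feasible_value T \<omega> - model \<omega> T y + Lam T * (\<mu> * (norm (X \<omega> T - y))\<^sup>2)"
      unfolding eq using Lam by (simp add: field_simps)
    also have "Lam T * (\<mu> * (norm (X \<omega> T - y))\<^sup>2) = 2 * (model \<omega> T y - model \<omega> T (X \<omega> T))"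
      using model_quadratic[OF \<omega>, of T y] by (simp add: norm_minus_commute)
    also have "feasible_value T \<omega> - model \<omega> T y + 2 * (model \<omega> T y - model \<omega> T (X \<omega> T))
        \<le> (\<Sum>k<T. lam k * active (X \<omega> k) (X \<omega> k)) + model \<omega> T y
          - 2 * (\<Sum>k<T. lam k * (active (X \<omega> k) (X \<omega> k) - \<alpha> k / 2 * (norm (G \<omega> k + shift (X \<omega> k)))\<^sup>2))"
      using feasible_value_le[of T \<omega>] model_lower[OF \<omega>, of T] by simp
    also have "\<dots> = ?B \<omega>"
      unfolding aggregate_model_eq_sum sum_distrib_left sum.distrib[symmetric] sum_subtractf[symmetric]
      by (intro sum.cong) (auto simp: algebra_simps)
    finally show ?thesis .
  qed
  have "AE \<omega> in P. gap T \<omega> * Lam T \<le> ?B \<omega>"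
    using AE_eq AE_space by eventually_elim (rule pathwise)
  then have "(\<integral>\<omega>. gap T \<omega> * Lam T \<partial>P) \<le> (\<integral>\<omega>. ?B \<omega> \<partial>P)"
    using gap_int B_int by (intro integral_mono_AE) auto
  then have "(\<integral>\<omega>. gap T \<omega> \<partial>P) * Lam T \<le> (\<integral>\<omega>. ?B \<omega> \<partial>P)" by simp
  also have "\<dots> = (\<Sum>k<T. lam k * ((\<integral>\<omega>. model_piece f r sel \<mu> \<alpha> (X \<omega>) (G \<omega>) k y \<partial>P)
      - (\<integral>\<omega>. active (X \<omega> k) (X \<omega> k) \<partial>P) + \<alpha> k * (\<integral>\<omega>. (norm (G \<omega> k + shift (X \<omega> k)))\<^sup>2 \<partial>P)))"
    using model_piece_expectation(1) active_integrable shifted_grad_moment(1)[OF square_integrable] by simp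
  also have "\<dots> \<le> (\<Sum>k<T. lam k * (\<alpha> k * L0\<^sup>2 + (L1 * \<alpha> k - 1) * (\<integral>\<omega>. \<delta> (X \<omega> k) \<partial>P)))"
  proof (intro sum_mono mult_left_mono)
    fix k
    have "(\<integral>\<omega>. \<delta> (X \<omega> k) \<partial>P) = (\<integral>\<omega>. active (X \<omega> k) (X \<omega> k) \<partial>P) - (\<integral>\<omega>. active (X \<omega> k) y \<partial>P)"
      unfolding delta_eq using active_integrable active_y_integrable by simp
    moreover have "\<alpha> k * (\<integral>\<omega>. (norm (G \<omega> k + shift (X \<omega> k)))\<^sup>2 \<partial>P)
        \<le> \<alpha> k * (L0\<^sup>2 + L1 * (\<integral>\<omega>. \<delta> (X \<omega> k) \<partial>P))"
      using shifted_grad_moment(2)[OF square_integrable, of k] alpha_pos[of k] by simp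
    ultimately show "(\<integral>\<omega>. model_piece f r sel \<mu> \<alpha> (X \<omega>) (G \<omega>) k y \<partial>P)
      - (\<integral>\<omega>. active (X \<omega> k) (X \<omega> k) \<partial>P) + \<alpha> k * (\<integral>\<omega>. (norm (G \<omega> k + shift (X \<omega> k)))\<^sup>2 \<partial>P)
      \<le> \<alpha> k * L0\<^sup>2 + (L1 * \<alpha> k - 1) * (\<integral>\<omega>. \<delta> (X \<omega> k) \<partial>P)"
      using model_piece_expectation(2)[of k] by (simp add: algebra_simps)
  qed (use lam_pos in \<open>auto intro: less_imp_le\<close>)
  also have "\<dots> = L0\<^sup>2 * (\<Sum>k<T. lam k * \<alpha> k)
      + (\<Sum>k<T. lam k * ((L1 * \<alpha> k - 1) * (\<integral>\<omega>. \<delta> (X \<omega> k) \<partial>P)))"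
    unfolding sum_distrib_left sum.distrib[symmetric] by (intro sum.cong) (auto simp: algebra_simps)
  finally show "(\<integral>\<omega>. gap T \<omega> \<partial>P) * Lam T \<le> L0\<^sup>2 * (\<Sum>k<T. lam k * \<alpha> k)
      + (\<Sum>k<T. lam k * ((L1 * \<alpha> k - 1) * (\<integral>\<omega>. \<delta> (X \<omega> k) \<partial>P)))" .
qed

end

section \<open>The constant and the convergence bound\<close>

text \<open>A step with \<open>L1 \<alpha>\<^sub>k > 1\<close> has an index at most the supremum of such indices, whether or not this is
  finite, so its term occurs in the series. The series has nonnegative terms and hence converges in the
  extended reals, possibly to \<open>\<infinity>\<close>.\<close>

lemma partial_sum_le_C_const:
  assumes opt_nonneg: "\<And>k. 0 \<le> d_opt k" and lam_nonneg: "\<And>k. 0 \<le> lam k"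
  shows "ereal (\<Sum>k<T. lam k * ((L1 * \<alpha> k - 1) * d_opt k)) \<le> C_const L1 \<alpha> lam d_opt d_sl"
proof -
  define a where "a k = lam k * max (L1 * \<alpha> k - 1) 0 * max (d_opt k) (d_sl k)" for k
  define S where "S = {k. ereal (real k) \<le> T_const L1 \<alpha>}"
  have a: "0 \<le> a k" for k
    using opt_nonneg[of k] lam_nonneg[of k] by (auto simp: a_def le_max_iff_disj)
  have "(\<Sum>k<T. lam k * ((L1 * \<alpha> k - 1) * d_opt k)) \<le> (\<Sum>k\<in>{k. k < T \<and> L1 * \<alpha> k > 1}. a k)"
    unfolding sum_if_less
  proof (rule sum_mono)
    fix k
    show "lam k * ((L1 * \<alpha> k - 1) * d_opt k) \<le> (if 1 < L1 * \<alpha> k then a k else 0)"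
    proof (cases "1 < L1 * \<alpha> k")
      case True
      then have "lam k * (L1 * \<alpha> k - 1) * d_opt k \<le> lam k * (L1 * \<alpha> k - 1) * max (d_opt k) (d_sl k)"
        using lam_nonneg[of k] by (intro mult_left_mono) auto
      then show ?thesis using True by (simp add: a_def max_def mult.assoc)
    next
      case False
      then have "(L1 * \<alpha> k - 1) * d_opt k \<le> 0"
        using opt_nonneg[of k] by (intro mult_nonpos_nonneg) auto
      then show ?thesis using False lam_nonneg[of k] by (simp add: mult_nonneg_nonpos)
    qed
  qed
  then have "ereal (\<Sum>k<T. lam k * ((L1 * \<alpha> k - 1) * d_opt k))
      \<le> (\<Sum>k\<in>{k. k < T \<and> L1 * \<alpha> k > 1}. ereal (a k))"
    by simp
  also have "\<dots> = (\<Sum>\<^sub>\<infinity>k\<in>{k. k < T \<and> L1 * \<alpha> k > 1}. ereal (a k))" by simp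
  also have "\<dots> \<le> (\<Sum>\<^sub>\<infinity>k\<in>S. ereal (a k))"
  proof (rule infsum_mono_neutral)
    show "(\<lambda>k. ereal (a k)) summable_on {k. k < T \<and> L1 * \<alpha> k > 1}" by simp
    show "(\<lambda>k. ereal (a k)) summable_on S"
      using a by (intro nonneg_summable_on_complete) simp
    have "{k. k < T \<and> L1 * \<alpha> k > 1} \<subseteq> S"
      unfolding S_def T_const_def by (auto intro: SUP_upper2)
    then show "ereal (a k) \<le> 0" if "k \<in> {k. k < T \<and> L1 * \<alpha> k > 1} - S" for k
      using that by blast
  qed (use a in auto)
  also have "\<dots> = C_const L1 \<alpha> lam d_opt d_sl" by (simp add: C_const_def S_def a_def)
  finally show ?thesis .
qed

theorem theorem3p2:
  fixes f :: "nat \<Rightarrow> 'a::euclidean_space \<Rightarrow> real"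
    and m :: nat
    and r :: "'a \<Rightarrow> ereal"
    and sel :: "'a \<Rightarrow> nat"
    and g :: "nat \<Rightarrow> 'a \<Rightarrow> 'z \<Rightarrow> 'a"
    and D :: "'z measure"
    and P :: "'w measure"
    and \<xi> :: "nat \<Rightarrow> 'w \<Rightarrow> 'z"
    and X G :: "'w \<Rightarrow> nat \<Rightarrow> 'a"
    and x0 x_opt x_sl n_opt n_sl :: 'a
    and \<mu> L0 L1 :: real
    and \<alpha> lam :: "nat \<Rightarrow> real"
    and T :: nat
  assumes r: "proper_closed_convex r"
    and sel: "selection_rule f m sel" "sel \<in> borel \<rightarrow>\<^sub>M count_space UNIV"
    and P: "prob_space P"
    and iid: "prob_space.indep_vars P (\<lambda>_. D) \<xi> UNIV" "\<forall>k. distr P D (\<xi> k) = D"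
    and oracle_measurable:
      "\<forall>i\<le>m. (\<lambda>(u, z). g i u z) \<in> borel_measurable (borel \<Otimes>\<^sub>M D)"
    and oracle_unbiased:
      "\<forall>i\<le>m. \<forall>u. integrable D (g i u) \<and>
        (\<integral>z. g i u z \<partial>D) \<in> subdiff (\<lambda>y. ereal (f i y)) u"
    and method_init: "\<forall>\<omega>\<in>space P. X \<omega> 0 = x0"
    and method_step: "\<forall>\<omega>\<in>space P. \<forall>k. X \<omega> (Suc k) =
      (if feasible f m (X \<omega> k)
       then prox (\<alpha> k) r (X \<omega> k - \<alpha> k *\<^sub>R g 0 (X \<omega> k) (\<xi> k \<omega>))
       else X \<omega> k - \<alpha> k *\<^sub>R g (sel (X \<omega> k)) (X \<omega> k) (\<xi> k \<omega>))"
    and oracle_output: "\<forall>\<omega>\<in>space P. \<forall>k. G \<omega> k = g (sel (X \<omega> k)) (X \<omega> k) (\<xi> k \<omega>)"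
    and assumption_A: "\<mu> > 0" "\<forall>i\<le>m. strongly_convex \<mu> (f i)"
    and assumption_B: "n_sl \<in> subdiff r x_sl" "\<forall>i\<in>{1..m}. f i x_sl < 0"
    and x_opt: "is_arg_min (objective f r) (feasible f m) x_opt"
    and n_opt: "n_opt \<in> subdiff r x_opt"
      "is_arg_min (lin_obj f r x_opt n_opt) (feasible f m) x_opt"
    and L: "L0 \<ge> 0" "L1 \<ge> 0"
    and assumption_C:
      "AE \<omega> in P. \<forall>k. \<forall>(y, n)\<in>{(x_opt, n_opt), (x_sl, n_sl)}.
        (feasible f m (X \<omega> k) \<longrightarrow>
           integrable D (\<lambda>z. (norm (g 0 (X \<omega> k) z + n))\<^sup>2) \<and>
           (\<integral>z. (norm (g 0 (X \<omega> k) z + n))\<^sup>2 \<partial>D)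
             \<le> L0\<^sup>2 + L1 * delta f m r sel y n (X \<omega> k)) \<and>
        (\<not> feasible f m (X \<omega> k) \<longrightarrow>
           integrable D (\<lambda>z. (norm (g (sel (X \<omega> k)) (X \<omega> k) z))\<^sup>2) \<and>
           (\<integral>z. (norm (g (sel (X \<omega> k)) (X \<omega> k) z))\<^sup>2 \<partial>D)
             \<le> L0\<^sup>2 + L1 * delta f m r sel y n (X \<omega> k))"
    and stepsizes: "\<forall>k. \<alpha> k > 0" "\<forall>k. lam k > 0"
      "\<forall>k. \<alpha> k = lam k / (\<mu> * (\<Sum>i\<le>k. lam i))"
    and T: "T \<ge> 1" "AE \<omega> in P. feasible_weight sel lam (X \<omega>) T > 0"
  shows "let Z = (\<lambda>\<omega>.
      feasible_weight sel lam (X \<omega>) T / (\<Sum>k<T. lam k) *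
        (primal_gap f m r sel x_opt n_opt lam (X \<omega>) T +
         dual_gap f m r sel \<mu> \<alpha> lam (X \<omega>) (G \<omega>) T)
      + \<mu> / 2 * (norm (X \<omega> T - x_opt))\<^sup>2)
    in integrable P Z \<and>
    ereal (\<integral>\<omega>. Z \<omega> \<partial>P)
      \<le> (ereal (L0\<^sup>2 * (\<Sum>k<T. lam k * \<alpha> k))
           + C_const L1 \<alpha> lam
               (\<lambda>k. \<integral>\<omega>. delta f m r sel x_opt n_opt (X \<omega> k) \<partial>P)
               (\<lambda>k. \<integral>\<omega>. delta f m r sel x_sl n_sl (X \<omega> k) \<partial>P))
         / ereal (\<Sum>k<T. lam k)"
proof -
  let ?d_opt = "\<lambda>k. \<integral>\<omega>. delta f m r sel x_opt n_opt (X \<omega> k) \<partial>P"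
  let ?d_sl = "\<lambda>k. \<integral>\<omega>. delta f m r sel x_sl n_sl (X \<omega> k) \<partial>P"
  have moment: "AE \<omega> in P. \<forall>k.
      (feasible f m (X \<omega> k) \<longrightarrow>
         integrable D (\<lambda>z. (norm (g 0 (X \<omega> k) z + n_opt))\<^sup>2) \<and>
         (\<integral>z. (norm (g 0 (X \<omega> k) z + n_opt))\<^sup>2 \<partial>D)
           \<le> L0\<^sup>2 + L1 * delta f m r sel x_opt n_opt (X \<omega> k)) \<and>
      (\<not> feasible f m (X \<omega> k) \<longrightarrow>
         integrable D (\<lambda>z. (norm (g (sel (X \<omega> k)) (X \<omega> k) z))\<^sup>2) \<and>
         (\<integral>z. (norm (g (sel (X \<omega> k)) (X \<omega> k) z))\<^sup>2 \<partial>D)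
           \<le> L0\<^sup>2 + L1 * delta f m r sel x_opt n_opt (X \<omega> k))"
    using assumption_C
  proof eventually_elim
    case (elim \<omega>)
    show ?case
    proof (rule allI, goal_cases)
      case (1 k)
      \<comment> \<open>\<open>insertI1\<close> selects the reference pair belonging to the minimizer.\<close>
      from bspec[OF spec[OF elim, of k] insertI1] show ?case by (simp only: prod.case)
    qed
  qed
  interpret prob_space P by (rule P)
  interpret switching_method P f m r sel g D \<xi> X G x0 x_opt n_opt \<mu> L0 L1 \<alpha> lam
  proof unfold_locales
    show "feasible f m x_opt" using x_opt by (simp add: is_arg_min_def)
  qed (rule r sel iid n_opt moment L assumption_A
      iid(2)[rule_format] oracle_measurable[rule_format]
      oracle_unbiased[rule_format, THEN conjunct1] oracle_unbiased[rule_format, THEN conjunct2]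
      method_init[rule_format] method_step[rule_format] oracle_output[rule_format]
      assumption_A(2)[rule_format] stepsizes(2,3)[rule_format] | assumption)+
  have Lam: "Lam T > 0" using T(1) by (rule Lam_pos)
  have "ereal (\<Sum>k<T. lam k * ((L1 * \<alpha> k - 1) * ?d_opt k)) \<le> C_const L1 \<alpha> lam ?d_opt ?d_sl"
  proof (rule partial_sum_le_C_const)
    show "0 \<le> ?d_opt k" for k by (intro Bochner_Integration.integral_nonneg delta_nonneg)
    show "0 \<le> lam k" for k using stepsizes(2) less_imp_le by blast
  qed
  from add_left_mono[OF this, of "ereal (L0\<^sup>2 * (\<Sum>k<T. lam k * \<alpha> k))"]
  have "ereal ((\<integral>\<omega>. gap T \<omega> \<partial>P) * Lam T)
      \<le> ereal (L0\<^sup>2 * (\<Sum>k<T. lam k * \<alpha> k)) + C_const L1 \<alpha> lam ?d_opt ?d_sl"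
    unfolding plus_ereal.simps(1)
    by (rule order_trans[rotated]) (simp only: ereal_less_eq(3) expected_gap_bound(2)[OF T])
  then have "ereal (\<integral>\<omega>. gap T \<omega> \<partial>P)
      \<le> (ereal (L0\<^sup>2 * (\<Sum>k<T. lam k * \<alpha> k)) + C_const L1 \<alpha> lam ?d_opt ?d_sl) / ereal (Lam T)"
    using Lam by (subst ereal_le_divide_pos) (simp_all add: mult.commute)
  with expected_gap_bound(1)[OF T] show ?thesis
    unfolding gap_def[abs_def] Let_def by (rule conjI)
qed

end
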